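(* Let $A$ and $B$ be groups, let $H \leqslant A$ and $K \leqslant B$ be subgroups, let $\varphi\colon H \to K$ be an isomorphism, and let $$G=\langle A * B;\ H = K,\ \varphi \rangle$$ be the free product of $A$ and $B$ with subgroups $H$ and $K$ amalgamated according to $\varphi$. Suppose that $H$ is a retract of $A$ and $K$ is a retract of $B$. Let $p$ be a prime number. Then $G$ is residually finite if, and only if, both $A$ and $B$ are residually finite; and $G$ is residually $p$-finite if, and only if, both $A$ and $B$ are residually $p$-finite.
   Context: The free product with amalgamation $\langle A * B;\ H=K,\ \varphi\rangle$ is the quotient of the free product $A * B$ by the normal closure of the elements $h^{-1}(h\varphi)$, $h \in H$. A subgroup $Y$ of a group $X$ is a retract of $X$ if there exists a normal subgroup $F$ of $X$ such that $X = YF$ and $Y \cap F = 1$. A group $X$ is residually finite (respectively residually $p$-finite, for a fixed prime $p$) if for every $g \in X$, $g \neq 1$, there exists a homomorphism $\psi$ of $X$ onto a finite group (respectively onto a finite $p$-group) such that $g\psi \neq 1$. *)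

theory Defs
  imports "HOL-Algebra.Coset" "HOL-Computational_Algebra.Primes"
begin

section \<open>Free products\<close>

text \<open>
  The free product of \<open>A\<close> and \<open>B\<close> consists of the words over the disjoint union of the carriers,
  modulo the congruence that deletes the two identity letters and multiplies adjacent letters
  coming from the same factor.
\<close>

definition fp_words :: "('a, 'm) monoid_scheme \<Rightarrow> ('b, 'n) monoid_scheme \<Rightarrow> ('a + 'b) list set"
  where "fp_words A B = lists (carrier A <+> carrier B)"

inductive fp_eq ::
  "('a, 'm) monoid_scheme \<Rightarrow> ('b, 'n) monoid_scheme \<Rightarrow> ('a + 'b) list \<Rightarrow> ('a + 'b) list \<Rightarrow> bool"
  for A B where
  refl: "w \<in> fp_words A B \<Longrightarrow> fp_eq A B w w"
| sym: "fp_eq A B u v \<Longrightarrow> fp_eq A B v u"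
| trans: "fp_eq A B u v \<Longrightarrow> fp_eq A B v w \<Longrightarrow> fp_eq A B u w"
| append: "fp_eq A B u u' \<Longrightarrow> fp_eq A B v v' \<Longrightarrow> fp_eq A B (u @ v) (u' @ v')"
| one_left: "fp_eq A B [Inl \<one>\<^bsub>A\<^esub>] []"
| one_right: "fp_eq A B [Inr \<one>\<^bsub>B\<^esub>] []"
| mult_left: "x \<in> carrier A \<Longrightarrow> y \<in> carrier A \<Longrightarrow> fp_eq A B [Inl x, Inl y] [Inl (x \<otimes>\<^bsub>A\<^esub> y)]"
| mult_right: "x \<in> carrier B \<Longrightarrow> y \<in> carrier B \<Longrightarrow> fp_eq A B [Inr x, Inr y] [Inr (x \<otimes>\<^bsub>B\<^esub> y)]"

definition fp_class ::
  "('a, 'm) monoid_scheme \<Rightarrow> ('b, 'n) monoid_scheme \<Rightarrow> ('a + 'b) list \<Rightarrow> ('a + 'b) list set"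
  where "fp_class A B w = {v. fp_eq A B w v}"

definition free_product ::
  "('a, 'm) monoid_scheme \<Rightarrow> ('b, 'n) monoid_scheme \<Rightarrow> ('a + 'b) list set monoid"
  where "free_product A B =
    \<lparr>carrier = fp_class A B ` fp_words A B,
     monoid.mult = (\<lambda>U V. \<Union>u\<in>U. \<Union>v\<in>V. fp_class A B (u @ v)),
     one = fp_class A B []\<rparr>"

definition fp_inl ::
  "('a, 'm) monoid_scheme \<Rightarrow> ('b, 'n) monoid_scheme \<Rightarrow> 'a \<Rightarrow> ('a + 'b) list set"
  where "fp_inl A B x = fp_class A B [Inl x]"

definition fp_inr ::
  "('a, 'm) monoid_scheme \<Rightarrow> ('b, 'n) monoid_scheme \<Rightarrow> 'b \<Rightarrow> ('a + 'b) list set"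
  where "fp_inr A B y = fp_class A B [Inr y]"

lemma fp_class_eq_iff:
  assumes "u \<in> fp_words A B"
  shows "fp_class A B u = fp_class A B v \<longleftrightarrow> fp_eq A B u v"
  using assms by (auto simp: fp_class_def intro: fp_eq.refl fp_eq.sym fp_eq.trans)

lemma fp_words_append: "u \<in> fp_words A B \<Longrightarrow> v \<in> fp_words A B \<Longrightarrow> u @ v \<in> fp_words A B"
  by (simp add: fp_words_def)

lemma fp_mult_class:
  assumes "u \<in> fp_words A B" "v \<in> fp_words A B"
  shows "fp_class A B u \<otimes>\<^bsub>free_product A B\<^esub> fp_class A B v = fp_class A B (u @ v)"
proof -
  have eq: "fp_class A B (u' @ v') = fp_class A B (u @ v)"
    if "u' \<in> fp_class A B u" "v' \<in> fp_class A B v" for u' v'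
  proof -
    have "fp_eq A B (u @ v) (u' @ v')"
      using that by (intro fp_eq.append) (simp_all add: fp_class_def)
    then show ?thesis
      using fp_class_eq_iff[OF fp_words_append[OF assms], of "u' @ v'"] by simp
  qed
  have ne: "u \<in> fp_class A B u" "v \<in> fp_class A B v"
    using assms by (simp_all add: fp_class_def fp_eq.refl)
  have "(\<Union>u'\<in>fp_class A B u. \<Union>v'\<in>fp_class A B v. fp_class A B (u' @ v')) =
      (\<Union>u'\<in>fp_class A B u. \<Union>v'\<in>fp_class A B v. fp_class A B (u @ v))"
    by (intro SUP_cong HOL.refl eq)
  also have "\<dots> = fp_class A B (u @ v)"
    using ne by blast
  finally show ?thesis
    by (simp add: free_product_def)
qed

lemma fp_word_inverse:
  assumes "group A" "group B" "w \<in> fp_words A B"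
  shows "\<exists>v\<in>fp_words A B. fp_eq A B (v @ w) []"
proof -
  interpret A: group A by fact
  interpret B: group B by fact
  have step: "\<exists>v\<in>fp_words A B. fp_eq A B (v @ x # w) []"
    if x: "x \<in> carrier A <+> carrier B" and w: "w \<in> fp_words A B"
      and v: "v \<in> fp_words A B" "fp_eq A B (v @ w) []" for x w v
  proof -
    obtain y where y: "y \<in> carrier A <+> carrier B" "fp_eq A B [y, x] []"
    proof (cases x)
      case (Inl a)
      then have a: "a \<in> carrier A" using x by auto
      have "fp_eq A B [Inl (inv\<^bsub>A\<^esub> a), Inl a] [Inl \<one>\<^bsub>A\<^esub>]"
        using fp_eq.mult_left[of "inv\<^bsub>A\<^esub> a" A a B] a by simp
      then have "fp_eq A B [Inl (inv\<^bsub>A\<^esub> a), x] []"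
        using Inl fp_eq.one_left fp_eq.trans by metis
      then show ?thesis using a that by blast
    next
      case (Inr b)
      then have b: "b \<in> carrier B" using x by auto
      have "fp_eq A B [Inr (inv\<^bsub>B\<^esub> b), Inr b] [Inr \<one>\<^bsub>B\<^esub>]"
        using fp_eq.mult_right[of "inv\<^bsub>B\<^esub> b" B b A] b by simp
      then have "fp_eq A B [Inr (inv\<^bsub>B\<^esub> b), x] []"
        using Inr fp_eq.one_right fp_eq.trans by metis
      then show ?thesis using b that by blast
    qed
    have "fp_eq A B (v @ ([y, x] @ w)) (v @ ([] @ w))"
      by (intro fp_eq.append fp_eq.refl y v w)
    then have "fp_eq A B ((v @ [y]) @ x # w) []"
      using v(2) fp_eq.trans by force
    moreover have "v @ [y] \<in> fp_words A B"
      using v(1) y(1) by (auto simp: fp_words_def)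
    ultimately show ?thesis by blast
  qed
  show ?thesis
    using assms(3)
  proof (induction w)
    case Nil
    then show ?case by (intro bexI[of _ "[]"]) (auto intro: fp_eq.refl)
  next
    case (Cons x w)
    then have "x \<in> carrier A <+> carrier B" "w \<in> fp_words A B"
      by (auto simp: fp_words_def)
    then show ?case using Cons.IH step by blast
  qed
qed

lemma group_free_product:
  assumes "group A" "group B"
  shows "group (free_product A B)"
proof (rule groupI)
  have carr: "carrier (free_product A B) = fp_class A B ` fp_words A B"
    and one: "\<one>\<^bsub>free_product A B\<^esub> = fp_class A B []"
    by (simp_all add: free_product_def)
  have nil: "[] \<in> fp_words A B" by (simp add: fp_words_def)
  show "\<one>\<^bsub>free_product A B\<^esub> \<in> carrier (free_product A B)"
    using carr one nil by auto
  fix U assume "U \<in> carrier (free_product A B)"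
  then obtain u where u: "U = fp_class A B u" "u \<in> fp_words A B" using carr by auto
  show "\<one>\<^bsub>free_product A B\<^esub> \<otimes>\<^bsub>free_product A B\<^esub> U = U"
    using u nil by (simp add: one fp_mult_class)
  obtain v where v: "v \<in> fp_words A B" "fp_eq A B (v @ u) []"
    using fp_word_inverse[OF assms u(2)] by blast
  have "fp_class A B v \<otimes>\<^bsub>free_product A B\<^esub> U = \<one>\<^bsub>free_product A B\<^esub>"
    using u v fp_class_eq_iff[OF fp_words_append[OF v(1) u(2)]] by (simp add: one fp_mult_class)
  then show "\<exists>V\<in>carrier (free_product A B). V \<otimes>\<^bsub>free_product A B\<^esub> U = \<one>\<^bsub>free_product A B\<^esub>"
    using carr v by blast
  fix V assume "V \<in> carrier (free_product A B)"
  then obtain v where v: "V = fp_class A B v" "v \<in> fp_words A B" using carr by auto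
  show "U \<otimes>\<^bsub>free_product A B\<^esub> V \<in> carrier (free_product A B)"
    using u v by (auto simp: carr fp_mult_class fp_words_append)
  fix W assume "W \<in> carrier (free_product A B)"
  then obtain w where w: "W = fp_class A B w" "w \<in> fp_words A B" using carr by auto
  show "U \<otimes>\<^bsub>free_product A B\<^esub> V \<otimes>\<^bsub>free_product A B\<^esub> W =
      U \<otimes>\<^bsub>free_product A B\<^esub> (V \<otimes>\<^bsub>free_product A B\<^esub> W)"
    using u v w by (simp add: fp_mult_class fp_words_append)
qed

lemma fp_inl_hom: "fp_inl A B \<in> hom A (free_product A B)"
proof (rule homI)
  fix x y assume xy: "x \<in> carrier A" "y \<in> carrier A"
  then have w: "[Inl x] \<in> fp_words A B" "[Inl y] \<in> fp_words A B" by (auto simp: fp_words_def)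
  show "fp_inl A B x \<in> carrier (free_product A B)"
    using w by (simp add: fp_inl_def free_product_def)
  show "fp_inl A B (x \<otimes>\<^bsub>A\<^esub> y) = fp_inl A B x \<otimes>\<^bsub>free_product A B\<^esub> fp_inl A B y"
    using fp_eq.mult_left[OF xy, of B]
      fp_class_eq_iff[OF fp_words_append[OF w], of "[Inl (x \<otimes>\<^bsub>A\<^esub> y)]"]
    by (simp add: fp_inl_def fp_mult_class[OF w])
qed

lemma fp_inr_hom: "fp_inr A B \<in> hom B (free_product A B)"
proof (rule homI)
  fix x y assume xy: "x \<in> carrier B" "y \<in> carrier B"
  then have w: "[Inr x] \<in> fp_words A B" "[Inr y] \<in> fp_words A B" by (auto simp: fp_words_def)
  show "fp_inr A B x \<in> carrier (free_product A B)"
    using w by (simp add: fp_inr_def free_product_def)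
  show "fp_inr A B (x \<otimes>\<^bsub>B\<^esub> y) = fp_inr A B x \<otimes>\<^bsub>free_product A B\<^esub> fp_inr A B y"
    using fp_eq.mult_right[OF xy, of A]
      fp_class_eq_iff[OF fp_words_append[OF w], of "[Inr (x \<otimes>\<^bsub>B\<^esub> y)]"]
    by (simp add: fp_inr_def fp_mult_class[OF w])
qed

lemma free_product_extend:
  assumes "group A" "group B" "group Q" and f: "f \<in> hom A Q" and g: "g \<in> hom B Q"
  shows "\<exists>h\<in>hom (free_product A B) Q.
    (\<forall>x\<in>carrier A. h (fp_inl A B x) = f x) \<and> (\<forall>y\<in>carrier B. h (fp_inr A B y) = g y)"
proof -
  interpret Q: group Q by fact
  interpret f: group_hom A Q f using assms by (simp add: group_hom_def group_hom_axioms_def)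
  interpret g: group_hom B Q g using assms by (simp add: group_hom_def group_hom_axioms_def)
  define e where "e w = foldr (\<lambda>x. (\<otimes>\<^bsub>Q\<^esub>) (case_sum f g x)) w \<one>\<^bsub>Q\<^esub>" for w
  have e_simps: "e [] = \<one>\<^bsub>Q\<^esub>" "e (x # w) = case_sum f g x \<otimes>\<^bsub>Q\<^esub> e w" for x w
    by (simp_all add: e_def)
  have e_carr: "e w \<in> carrier Q" if "w \<in> fp_words A B" for w
    using that by (induction w) (auto simp: e_simps fp_words_def)
  have e_app: "e (u @ v) = e u \<otimes>\<^bsub>Q\<^esub> e v" if "u \<in> fp_words A B" "v \<in> fp_words A B" for u v
    using that(1)
  proof (induction u)
    case Nil
    then show ?case using e_carr[OF that(2)] by (simp add: e_simps)
  next
    case (Cons x u)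
    then have "u \<in> fp_words A B" "case_sum f g x \<in> carrier Q" by (auto simp: fp_words_def)
    then show ?case using Cons.IH e_carr that(2) by (simp add: e_simps Q.m_assoc)
  qed
  have e_eq: "u \<in> fp_words A B \<and> v \<in> fp_words A B \<and> e u = e v" if "fp_eq A B u v" for u v
    using that by induction (auto simp: fp_words_append e_app, auto simp: e_simps fp_words_def)
  define h where "h U = e (SOME w. w \<in> U)" for U
  have h: "h (fp_class A B w) = e w" if "w \<in> fp_words A B" for w
  proof -
    have "w \<in> fp_class A B w" using that by (auto simp: fp_class_def intro: fp_eq.refl)
    then have "(SOME v. v \<in> fp_class A B w) \<in> fp_class A B w" by (rule someI)
    then show ?thesis using e_eq by (auto simp: h_def fp_class_def)
  qed
  have "h \<in> hom (free_product A B) Q"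
    by (rule homI) (auto simp: free_product_def[THEN arg_cong[of _ _ carrier]]
        h e_carr fp_mult_class fp_words_append e_app)
  moreover have "h (fp_inl A B x) = f x" if "x \<in> carrier A" for x
    using that h[of "[Inl x]"] by (auto simp: fp_inl_def fp_words_def e_simps)
  moreover have "h (fp_inr A B y) = g y" if "y \<in> carrier B" for y
    using that h[of "[Inr y]"] by (auto simp: fp_inr_def fp_words_def e_simps)
  ultimately show ?thesis by blast
qed

section \<open>Amalgamation\<close>

definition normal_closure :: "('a, 'm) monoid_scheme \<Rightarrow> 'a set \<Rightarrow> 'a set"
  where "normal_closure G S = \<Inter>{N. N \<lhd> G \<and> S \<subseteq> N}"

lemma (in group) normal_closure_normal:
  assumes "S \<subseteq> carrier G"
  shows "normal_closure G S \<lhd> G"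
proof -
  have ex: "carrier G \<in> {N. N \<lhd> G \<and> S \<subseteq> N}"
    using assms by (auto simp: normal_inv_iff subgroup_self)
  have "subgroup (\<Inter>{N. N \<lhd> G \<and> S \<subseteq> N}) G"
    using ex by (intro subgroups_Inter) (auto dest: normal_imp_subgroup)
  then show ?thesis
    unfolding normal_closure_def by (rule normal_invI) (auto simp: normal_inv_iff)
qed

text \<open>The subgroup \<open>K\<close> of \<open>B\<close> is the image of \<open>H\<close> under \<open>\<phi>\<close> and hence not a separate argument.\<close>

definition amalgamated_product ::
  "('a, 'm) monoid_scheme \<Rightarrow> ('b, 'n) monoid_scheme \<Rightarrow> 'a set \<Rightarrow> ('a \<Rightarrow> 'b)
    \<Rightarrow> ('a + 'b) list set set monoid"
  where "amalgamated_product A B H \<phi> =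
    free_product A B Mod
      normal_closure (free_product A B)
        {inv\<^bsub>free_product A B\<^esub> (fp_inl A B h) \<otimes>\<^bsub>free_product A B\<^esub> fp_inr A B (\<phi> h) |h. h \<in> H}"

lemma group_amalgamated_product:
  assumes "group A" "group B" "H \<subseteq> carrier A" "\<phi> ` H \<subseteq> carrier B"
  shows "group (amalgamated_product A B H \<phi>)"
proof -
  interpret P: group "free_product A B" using assms by (intro group_free_product)
  have "fp_inl A B h \<in> carrier (free_product A B)" "fp_inr A B (\<phi> h) \<in> carrier (free_product A B)"
    if "h \<in> H" for h
    using that assms(3,4) by (auto intro!: hom_in_carrier[OF fp_inl_hom] hom_in_carrier[OF fp_inr_hom])
  then show ?thesis
    unfolding amalgamated_product_def
    by (intro normal.factorgroup_is_group P.normal_closure_normal) auto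
qed

section \<open>Retracts and residual properties\<close>

definition retract_of :: "'a set \<Rightarrow> ('a, 'm) monoid_scheme \<Rightarrow> bool"
  where "retract_of Y G \<longleftrightarrow> subgroup Y G \<and>
    (\<exists>F. F \<lhd> G \<and> carrier G = Y <#>\<^bsub>G\<^esub> F \<and> Y \<inter> F = {\<one>\<^bsub>G\<^esub>})"

definition finite_p_group :: "nat \<Rightarrow> ('a, 'm) monoid_scheme \<Rightarrow> bool"
  where "finite_p_group p Q \<longleftrightarrow> group Q \<and> finite (carrier Q) \<and> (\<exists>n. order Q = p ^ n)"

text \<open>
  HOL cannot quantify over the element type of the finite quotient. Quantifying over groups whose
  elements are natural numbers is no restriction, since every finite group is isomorphic to such
  a group: see \<open>finite_group_iso_nat\<close> and \<open>epi_nat_quotient\<close>.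
\<close>

definition residually_finite :: "('a, 'm) monoid_scheme \<Rightarrow> bool"
  where "residually_finite G \<longleftrightarrow> (\<forall>g\<in>carrier G. g \<noteq> \<one>\<^bsub>G\<^esub> \<longrightarrow>
    (\<exists>(Q :: nat monoid) \<psi>. group Q \<and> finite (carrier Q) \<and> \<psi> \<in> epi G Q \<and> \<psi> g \<noteq> \<one>\<^bsub>Q\<^esub>))"

definition residually_p_finite :: "nat \<Rightarrow> ('a, 'm) monoid_scheme \<Rightarrow> bool"
  where "residually_p_finite p G \<longleftrightarrow> (\<forall>g\<in>carrier G. g \<noteq> \<one>\<^bsub>G\<^esub> \<longrightarrow>
    (\<exists>(Q :: nat monoid) \<psi>. finite_p_group p Q \<and> \<psi> \<in> epi G Q \<and> \<psi> g \<noteq> \<one>\<^bsub>Q\<^esub>))"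

lemma finite_group_iso_nat:
  fixes Q :: "('q, 'm) monoid_scheme"
  assumes "group Q" "finite (carrier Q)"
  shows "\<exists>(R :: nat monoid) i. group R \<and> finite (carrier R) \<and> order R = order Q \<and> i \<in> iso Q R"
proof -
  interpret Q: group Q by fact
  obtain i :: "'q \<Rightarrow> nat" where i: "inj_on i (carrier Q)"
    using assms(2) finite_imp_inj_to_nat_seg by metis
  define j where "j = the_inv_into (carrier Q) i"
  have j: "j (i x) = x" if "x \<in> carrier Q" for x
    using i that by (simp add: j_def the_inv_into_f_f)
  define R where "R = \<lparr>carrier = i ` carrier Q, monoid.mult = (\<lambda>x y. i (j x \<otimes>\<^bsub>Q\<^esub> j y)), one = i \<one>\<^bsub>Q\<^esub>\<rparr>"
  have "group R"
  proof (rule groupI)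
    fix x assume "x \<in> carrier R"
    then obtain a where a: "x = i a" "a \<in> carrier Q" by (auto simp: R_def)
    then show "\<exists>y\<in>carrier R. y \<otimes>\<^bsub>R\<^esub> x = \<one>\<^bsub>R\<^esub>"
      by (intro bexI[of _ "i (inv\<^bsub>Q\<^esub> a)"]) (auto simp: R_def j)
  qed (auto simp: R_def j Q.m_assoc)
  moreover have "i \<in> iso Q R"
    using i by (auto simp: R_def j iso_def hom_def bij_betw_def)
  moreover have "finite (carrier R)" "order R = order Q"
    using assms(2) i by (auto simp: R_def order_def card_image)
  ultimately show ?thesis by blast
qed

lemma epi_nat_quotient:
  fixes Q :: "('q, 'n) monoid_scheme"
  assumes "group Q" "finite (carrier Q)" "\<psi> \<in> epi G Q" "g \<in> carrier G" "\<psi> g \<noteq> \<one>\<^bsub>Q\<^esub>"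
  shows "\<exists>(R :: nat monoid) \<psi>'. group R \<and> finite (carrier R) \<and> order R = order Q \<and>
    \<psi>' \<in> epi G R \<and> \<psi>' g \<noteq> \<one>\<^bsub>R\<^esub>"
proof -
  obtain R :: "nat monoid" and i where R: "group R" "finite (carrier R)" "order R = order Q"
    and i: "i \<in> iso Q R"
    using finite_group_iso_nat[OF assms(1,2)] by blast
  have i': "i \<in> hom Q R" "inj_on i (carrier Q)" "i ` carrier Q = carrier R"
    using i by (auto simp: iso_def bij_betw_def)
  have \<psi>: "\<psi> \<in> hom G Q" "\<psi> ` carrier G = carrier Q"
    using assms(3) by (auto simp: epi_def)
  have "i \<circ> \<psi> \<in> epi G R"
    using i'(3) \<psi>(2) hom_compose[OF \<psi>(1) i'(1)] by (simp only: epi_def mem_Collect_eq image_comp[symmetric])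
  moreover have "i (\<psi> g) \<noteq> i \<one>\<^bsub>Q\<^esub>"
    using i'(2) assms(1,4,5) \<psi> by (metis group.is_monoid image_eqI inj_onD monoid.one_closed)
  then have "(i \<circ> \<psi>) g \<noteq> \<one>\<^bsub>R\<^esub>"
    using hom_one[OF i'(1) assms(1) R(1)] by simp
  ultimately show ?thesis using R by blast
qed

end

(*
  Finite groups and finite p-groups are treated alike: in both cases membership in the class depends
  on the order only, and the class is closed under subgroups and wreath products. Below, P, Q and
  all wreath products belong to the class.

  Let F_A and F_B be the kernels of the retractions A -> H and B -> K. Every element of G is a
  product of letters from F_A and F_B, followed by some h in H. The retraction of G to A sends it to
  h, so one may assume h = 1 and that the word is reduced, i.e. an alternating word of nontrivial
  letters.

  Free products are handled by induction on the length, in a family of copies of D = A x B: if Q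
  separates the word obtained by removing all letters of one copy and conjugating the other letters
  (Kurosh), and P is an image of the removed copy in which its letters survive, then Q wr P
  separates the given word. This yields maps alpha : A -> Q and beta : B -> Q for which the product
  of the word is not 1, but they need not agree on H = K.

  To repair this, put sigma(h) = (alpha(h), beta(h phi)). In the wreath product of Q by Q x Q, the
  maps a |-> (s |-> s_1 alpha(a) (s_1 alpha(a rho_A))^(-1), sigma(a rho_A)) and its analogue for B
  with s_2 and beta agree on H = K, and on F_A, F_B their component at s = 1 is alpha, beta.
*)
theory Submission
  imports Defs "HOL-Library.Nat_Bijection"
begin

section \<open>Classes of finite groups\<close>

definition finite_group_in :: "nat set \<Rightarrow> ('q, 'm) monoid_scheme \<Rightarrow> bool"
  where "finite_group_in N Q \<longleftrightarrow> group Q \<and> finite (carrier Q) \<and> order Q \<in> N"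

text \<open>Targets of arbitrary homomorphisms are allowed here, so that composites need not be cut
  down to their images. \<open>residually_in_epi_iff\<close> gives the link with
  surjections.\<close>

definition residually_in :: "nat set \<Rightarrow> ('a, 'm) monoid_scheme \<Rightarrow> bool"
  where "residually_in N G \<longleftrightarrow> (\<forall>g\<in>carrier G. g \<noteq> \<one>\<^bsub>G\<^esub> \<longrightarrow>
    (\<exists>(Q :: nat monoid) \<psi>. finite_group_in N Q \<and> \<psi> \<in> hom G Q \<and> \<psi> g \<noteq> \<one>\<^bsub>Q\<^esub>))"

text \<open>The class of groups is encoded by its set of orders. Divisors account for subgroups, by
  Lagrange, and products for direct products and wreath products.\<close>

locale finite_root_class =
  fixes N :: "nat set"
  assumes one_mem: "1 \<in> N"
    and mult_mem: "m \<in> N \<Longrightarrow> n \<in> N \<Longrightarrow> m * n \<in> N"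
    and dvd_mem: "n \<in> N \<Longrightarrow> m dvd n \<Longrightarrow> m \<in> N"
begin

lemma power_mem: "n \<in> N \<Longrightarrow> n ^ k \<in> N"
  by (induction k) (use one_mem in \<open>simp_all add: mult_mem\<close>)

end

lemma finite_root_class_UNIV: "finite_root_class UNIV"
  by unfold_locales auto

lemma finite_root_class_prime_powers:
  fixes p :: nat
  assumes "Factorial_Ring.prime p"
  shows "finite_root_class (range (\<lambda>n. p ^ n))"
proof
  show "1 \<in> range (\<lambda>n. p ^ n)"
    by (metis power_0 rangeI)
  show "m * n \<in> range (\<lambda>n. p ^ n)" if "m \<in> range (\<lambda>n. p ^ n)" "n \<in> range (\<lambda>n. p ^ n)" for m n
    using that by (auto simp flip: power_add)
  show "m \<in> range (\<lambda>n. p ^ n)" if "n \<in> range (\<lambda>n. p ^ n)" "m dvd n" for m n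
    using that divides_primepow_nat[OF assms] by blast
qed

text \<open>The image is a subgroup of \<open>Q\<close>, so its order divides \<open>order Q\<close>
  and stays in \<open>N\<close>.\<close>

lemma image_finite_group_in:
  assumes "finite_root_class N" "finite_group_in N Q" "group G" "\<psi> \<in> hom G Q"
  shows "finite_group_in N (Q\<lparr>carrier := \<psi> ` carrier G\<rparr>)"
proof -
  interpret Q: group Q using assms(2) by (simp add: finite_group_in_def)
  interpret \<psi>: group_hom G Q \<psi>
    using assms Q.group_axioms by (simp add: group_hom_def group_hom_axioms_def)
  have sub: "subgroup (\<psi> ` carrier G) Q" by (rule \<psi>.img_is_subgroup)
  have "card (\<psi> ` carrier G) dvd order Q"
    using Q.lagrange[OF sub] by (metis dvd_triv_right)
  then have "card (\<psi> ` carrier G) \<in> N"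
    using assms(1,2) finite_root_class.dvd_mem by (auto simp: finite_group_in_def)
  then show ?thesis
    using assms(2) Q.subgroup_imp_group[OF sub] finite_subset[OF subgroup.subset[OF sub]]
    by (simp add: finite_group_in_def order_def)
qed

text \<open>Shrinking the carrier of \<open>Q\<close> to the image of \<psi> makes \<psi> surjective
  and leaves the unit unchanged, so g still survives.\<close>

lemma residually_in_epi_iff:
  assumes "finite_root_class N" "group G"
  shows "residually_in N G \<longleftrightarrow> (\<forall>g\<in>carrier G. g \<noteq> \<one>\<^bsub>G\<^esub> \<longrightarrow>
    (\<exists>(Q :: nat monoid) \<psi>. finite_group_in N Q \<and> \<psi> \<in> epi G Q \<and> \<psi> g \<noteq> \<one>\<^bsub>Q\<^esub>))"
proof -
  have "\<exists>(R :: nat monoid) \<psi>. finite_group_in N R \<and> \<psi> \<in> epi G R \<and> \<psi> g \<noteq> \<one>\<^bsub>R\<^esub>"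
    if "finite_group_in N Q" "\<psi> \<in> hom G Q" "\<psi> g \<noteq> \<one>\<^bsub>Q\<^esub>" for Q :: "nat monoid" and \<psi> g
  proof (intro exI conjI)
    show "finite_group_in N (Q\<lparr>carrier := \<psi> ` carrier G\<rparr>)"
      using image_finite_group_in[OF assms(1) that(1) assms(2) that(2)] .
    show "\<psi> \<in> epi G (Q\<lparr>carrier := \<psi> ` carrier G\<rparr>)"
      using that(2) by (auto simp: epi_def hom_def)
    show "\<psi> g \<noteq> \<one>\<^bsub>Q\<lparr>carrier := \<psi> ` carrier G\<rparr>\<^esub>"
      using that(3) by simp
  qed
  moreover have "epi G Q \<subseteq> hom G Q" for Q :: "nat monoid"
    by (auto simp: epi_def)
  ultimately show ?thesis
    unfolding residually_in_def by (meson subsetD)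
qed

lemma residually_finite_iff:
  assumes "group G"
  shows "residually_finite G \<longleftrightarrow> residually_in UNIV G"
  unfolding residually_in_epi_iff[OF finite_root_class_UNIV assms]
  by (simp add: residually_finite_def finite_group_in_def conj_assoc)

lemma residually_p_finite_iff:
  assumes "group G" "Factorial_Ring.prime p"
  shows "residually_p_finite p G \<longleftrightarrow> residually_in (range (\<lambda>n. p ^ n)) G"
  unfolding residually_in_epi_iff[OF finite_root_class_prime_powers[OF assms(2)] assms(1)]
  by (simp add: residually_p_finite_def finite_p_group_def finite_group_in_def image_iff conj_assoc)

text \<open>Direct and wreath products leave the type \<open>nat monoid\<close> that
  \<open>residually_in\<close> demands. This copies them back injectively, so nontrivial elements
  stay nontrivial.\<close>

lemma finite_group_in_nat:
  fixes Q :: "('q, 'm) monoid_scheme"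
  assumes "finite_group_in N Q"
  obtains R :: "nat monoid" and i where "finite_group_in N R" "i \<in> hom Q R" "inj_on i (carrier Q)"
  using finite_group_iso_nat[of Q] assms that
  by (fastforce simp: finite_group_in_def iso_def bij_betw_def)

lemma hom_neq_one:
  assumes "group Q" "group R" "i \<in> hom Q R" "inj_on i (carrier Q)" "x \<in> carrier Q" "x \<noteq> \<one>\<^bsub>Q\<^esub>"
  shows "i x \<noteq> \<one>\<^bsub>R\<^esub>"
  using assms hom_one[OF assms(3,1,2)] by (metis group.is_monoid inj_onD monoid.one_closed)

lemma residually_in_by_embedding:
  assumes "residually_in N G" "group A" "group G" "f \<in> hom A G" "inj_on f (carrier A)"
  shows "residually_in N A"
  unfolding residually_in_def
proof (intro ballI impI)
  fix a assume a: "a \<in> carrier A" "a \<noteq> \<one>\<^bsub>A\<^esub>"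
  then have "f a \<noteq> \<one>\<^bsub>G\<^esub>" "f a \<in> carrier G"
    using assms hom_neq_one by (metis, metis hom_in_carrier)
  then obtain Q :: "nat monoid" and \<psi> where
    Q: "finite_group_in N Q" "\<psi> \<in> hom G Q" "\<psi> (f a) \<noteq> \<one>\<^bsub>Q\<^esub>"
    using assms(1) by (auto simp: residually_in_def)
  then show "\<exists>(Q :: nat monoid) \<psi>. finite_group_in N Q \<and> \<psi> \<in> hom A Q \<and> \<psi> a \<noteq> \<one>\<^bsub>Q\<^esub>"
    using hom_compose[OF assms(4) Q(2)] by (intro exI[of _ Q] exI[of _ "\<psi> \<circ> f"]) simp
qed

lemma DirProd_finite_group_in:
  assumes "finite_root_class N" "finite_group_in N P" "finite_group_in N Q"
  shows "finite_group_in N (P \<times>\<times> Q)"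
  using assms DirProd_group[of P Q] finite_root_class.mult_mem[OF assms(1), of "order P" "order Q"]
  by (simp add: finite_group_in_def order_def card_cartesian_product)

text \<open>A nontrivial pair has a nontrivial coordinate, and the projection to that factor is then
  separated further. The product serves as one common group containing both \<open>A\<close> and
  \<open>B\<close>.\<close>

lemma residually_in_DirProd:
  assumes "residually_in N A" "residually_in N B"
  shows "residually_in N (A \<times>\<times> B)"
  unfolding residually_in_def
proof (intro ballI impI)
  fix g assume g: "g \<in> carrier (A \<times>\<times> B)" "g \<noteq> \<one>\<^bsub>A \<times>\<times> B\<^esub>"
  obtain a b where ab: "g = (a, b)" "a \<in> carrier A" "b \<in> carrier B"
    using g(1) by auto
  have "a \<noteq> \<one>\<^bsub>A\<^esub> \<or> b \<noteq> \<one>\<^bsub>B\<^esub>"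
    using g(2) ab by auto
  then show "\<exists>(Q :: nat monoid) \<psi>. finite_group_in N Q \<and> \<psi> \<in> hom (A \<times>\<times> B) Q \<and> \<psi> g \<noteq> \<one>\<^bsub>Q\<^esub>"
  proof
    assume "a \<noteq> \<one>\<^bsub>A\<^esub>"
    then obtain Q :: "nat monoid" and \<psi> where
      "finite_group_in N Q" "\<psi> \<in> hom A Q" "\<psi> a \<noteq> \<one>\<^bsub>Q\<^esub>"
      using assms(1) ab by (auto simp: residually_in_def)
    then show ?thesis
      using ab by (intro exI[of _ Q] exI[of _ "\<psi> \<circ> fst"]) (auto simp: hom_def)
  next
    assume "b \<noteq> \<one>\<^bsub>B\<^esub>"
    then obtain Q :: "nat monoid" and \<psi> where
      "finite_group_in N Q" "\<psi> \<in> hom B Q" "\<psi> b \<noteq> \<one>\<^bsub>Q\<^esub>"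
      using assms(2) ab by (auto simp: residually_in_def)
    then show ?thesis
      using ab by (intro exI[of _ Q] exI[of _ "\<psi> \<circ> snd"]) (auto simp: hom_def)
  qed
qed

text \<open>Separating homomorphisms for single elements are collected into one homomorphism to the
  direct product of their targets.\<close>

lemma residually_in_finite_set:
  assumes "finite_root_class N" "residually_in N D" "group D"
    and "finite S" "S \<subseteq> carrier D - {\<one>\<^bsub>D\<^esub>}"
  shows "\<exists>(P :: nat monoid) \<pi>. finite_group_in N P \<and> \<pi> \<in> hom D P \<and> (\<forall>g\<in>S. \<pi> g \<noteq> \<one>\<^bsub>P\<^esub>)"
  using assms(4,5)
proof (induction S)
  case empty
  \<comment> \<open>The empty set is served by the trivial group, whose order 1 lies in
    \<open>N\<close>.\<close>
  define P :: "nat monoid" where "P = \<lparr>carrier = {0}, monoid.mult = (\<lambda>_ _. 0), one = 0\<rparr>"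
  have "group P"
    by (rule groupI) (auto simp: P_def)
  then have "finite_group_in N P"
    using finite_root_class.one_mem[OF assms(1)] by (simp add: finite_group_in_def order_def P_def)
  moreover have "(\<lambda>_. 0) \<in> hom D P"
    by (simp add: hom_def P_def)
  ultimately show ?case by blast
next
  case (insert g S)
  then obtain P :: "nat monoid" and \<pi> where
    P: "finite_group_in N P" "\<pi> \<in> hom D P" "\<forall>g\<in>S. \<pi> g \<noteq> \<one>\<^bsub>P\<^esub>" by auto
  obtain Q :: "nat monoid" and \<psi> where
    Q: "finite_group_in N Q" "\<psi> \<in> hom D Q" "\<psi> g \<noteq> \<one>\<^bsub>Q\<^esub>"
    using insert.prems assms(2) by (auto simp: residually_in_def)
  have PQ: "finite_group_in N (P \<times>\<times> Q)"
    using assms(1) P(1) Q(1) by (rule DirProd_finite_group_in)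
  then obtain R :: "nat monoid" and i where
    R: "finite_group_in N R" "i \<in> hom (P \<times>\<times> Q) R" "inj_on i (carrier (P \<times>\<times> Q))"
    using finite_group_in_nat by blast
  have h: "(\<lambda>x. (\<pi> x, \<psi> x)) \<in> hom D (P \<times>\<times> Q)"
    using P(2) Q(2) by (auto simp: hom_def)
  have "i (\<pi> x, \<psi> x) \<noteq> \<one>\<^bsub>R\<^esub>" if "x \<in> insert g S" for x
  proof -
    have "(\<pi> x, \<psi> x) \<noteq> \<one>\<^bsub>P \<times>\<times> Q\<^esub>" using P(3) Q(3) that by auto
    moreover have "(\<pi> x, \<psi> x) \<in> carrier (P \<times>\<times> Q)"
      using hom_in_carrier[OF h] that insert.prems by blast
    ultimately show ?thesis
      using PQ R hom_neq_one[of "P \<times>\<times> Q" R i] by (simp add: finite_group_in_def)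
  qed
  moreover have "(\<lambda>x. i (\<pi> x, \<psi> x)) \<in> hom D R"
    using hom_compose[OF h R(2)] by (simp add: comp_def)
  ultimately show ?case
    using R(1) by blast
qed

section \<open>Wreath products\<close>

text \<open>The complete wreath product with \<open>Q\<close> as base and \<open>P\<close> on top.
  Multiplying by (s, x) on the left reads s at h and moves the reading position of the next factor
  to h x. Extensional functions keep the carrier finite for finite groups.\<close>

definition wreath :: "('q, 'm) monoid_scheme \<Rightarrow> ('p, 'n) monoid_scheme \<Rightarrow> (('p \<Rightarrow> 'q) \<times> 'p) monoid"
  where "wreath Q P =
    \<lparr>carrier = (carrier P \<rightarrow>\<^sub>E carrier Q) \<times> carrier P,
     monoid.mult = (\<lambda>(s, x) (t, y). (\<lambda>h\<in>carrier P. s h \<otimes>\<^bsub>Q\<^esub> t (h \<otimes>\<^bsub>P\<^esub> x), x \<otimes>\<^bsub>P\<^esub> y)),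
     one = (\<lambda>h\<in>carrier P. \<one>\<^bsub>Q\<^esub>, \<one>\<^bsub>P\<^esub>)\<rparr>"

lemma group_wreath:
  assumes "group Q" "group P"
  shows "group (wreath Q P)"
proof (rule groupI)
  interpret Q: group Q by fact
  interpret P: group P by fact
  show "\<one>\<^bsub>wreath Q P\<^esub> \<in> carrier (wreath Q P)"
    by (auto simp: wreath_def)
  fix u assume u: "u \<in> carrier (wreath Q P)"
  obtain s x where sx: "u = (s, x)" "s \<in> carrier P \<rightarrow>\<^sub>E carrier Q" "x \<in> carrier P"
    using u by (auto simp: wreath_def)
  have s: "s h \<in> carrier Q" if "h \<in> carrier P" for h using sx that by auto
  show "\<one>\<^bsub>wreath Q P\<^esub> \<otimes>\<^bsub>wreath Q P\<^esub> u = u"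
    using sx by (auto simp: wreath_def s PiE_def extensional_def)
  \<comment> \<open>At h the product of \<open>?v\<close> and (s, x) reads s at h x^-1, so the base
    part of \<open>?v\<close> must be the inverse of that value.\<close>
  let ?v = "(\<lambda>h\<in>carrier P. inv\<^bsub>Q\<^esub> s (h \<otimes>\<^bsub>P\<^esub> inv\<^bsub>P\<^esub> x), inv\<^bsub>P\<^esub> x)"
  have "?v \<in> carrier (wreath Q P)" "?v \<otimes>\<^bsub>wreath Q P\<^esub> u = \<one>\<^bsub>wreath Q P\<^esub>"
    using sx by (auto simp: wreath_def s P.m_assoc)
  then show "\<exists>v\<in>carrier (wreath Q P). v \<otimes>\<^bsub>wreath Q P\<^esub> u = \<one>\<^bsub>wreath Q P\<^esub>" by blast
  fix v assume v: "v \<in> carrier (wreath Q P)"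
  obtain t y where ty: "v = (t, y)" "t \<in> carrier P \<rightarrow>\<^sub>E carrier Q" "y \<in> carrier P"
    using v by (auto simp: wreath_def)
  have t: "t h \<in> carrier Q" if "h \<in> carrier P" for h using ty that by auto
  show "u \<otimes>\<^bsub>wreath Q P\<^esub> v \<in> carrier (wreath Q P)"
    using sx ty by (auto simp: wreath_def s t)
  fix w assume w: "w \<in> carrier (wreath Q P)"
  obtain r z where rz: "w = (r, z)" "r \<in> carrier P \<rightarrow>\<^sub>E carrier Q" "z \<in> carrier P"
    using w by (auto simp: wreath_def)
  have r: "r h \<in> carrier Q" if "h \<in> carrier P" for h using rz that by auto
  show "u \<otimes>\<^bsub>wreath Q P\<^esub> v \<otimes>\<^bsub>wreath Q P\<^esub> w = u \<otimes>\<^bsub>wreath Q P\<^esub> (v \<otimes>\<^bsub>wreath Q P\<^esub> w)"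
    using sx ty rz by (auto simp: wreath_def s t r Q.m_assoc P.m_assoc)
qed

text \<open>The order is |Q|^|P| times |P|, a product of members of \<open>N\<close>.\<close>

lemma wreath_finite_group_in:
  assumes "finite_root_class N" "finite_group_in N Q" "finite_group_in N P"
  shows "finite_group_in N (wreath Q P)"
proof -
  have fin: "finite (carrier P)" "finite (carrier Q)"
    using assms by (auto simp: finite_group_in_def)
  then have "order (wreath Q P) = order Q ^ order P * order P"
    by (simp add: wreath_def order_def card_cartesian_product card_PiE)
  then have "order (wreath Q P) \<in> N"
    using assms finite_root_class.mult_mem finite_root_class.power_mem by (metis finite_group_in_def)
  moreover have "finite (carrier (wreath Q P))"
    using fin by (auto simp: wreath_def intro!: finite_PiE)
  ultimately show ?thesis
    using assms group_wreath by (auto simp: finite_group_in_def)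
qed

section \<open>Products of words\<close>

definition word_prod :: "('g, 'm) monoid_scheme \<Rightarrow> 'g list \<Rightarrow> 'g"
  where "word_prod G xs = foldr (\<otimes>\<^bsub>G\<^esub>) xs \<one>\<^bsub>G\<^esub>"

lemma word_prod_simps [simp]:
  "word_prod G [] = \<one>\<^bsub>G\<^esub>"
  "word_prod G (x # xs) = x \<otimes>\<^bsub>G\<^esub> word_prod G xs"
  by (simp_all add: word_prod_def)

lemma (in monoid) word_prod_closed: "set xs \<subseteq> carrier G \<Longrightarrow> word_prod G xs \<in> carrier G"
  by (induction xs) auto

lemma word_prod_hom:
  assumes "group G" "group Q" "f \<in> hom G Q" "set xs \<subseteq> carrier G"
  shows "f (word_prod G xs) = word_prod Q (map f xs)"
  using assms(4)
proof (induction xs)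
  case Nil
  then show ?case using hom_one[OF assms(3,1,2)] by simp
next
  case (Cons x xs)
  then show ?case
    using hom_mult[OF assms(3)] monoid.word_prod_closed[OF group.is_monoid[OF assms(1)]] by simp
qed

section \<open>Free products of copies of a residually finite group\<close>

text \<open>
  Kurosh-style rewriting: for a homomorphism \<open>\<pi>\<close> of the factor with index \<open>i\<^sub>0\<close> to a group \<open>P\<close>, the
  kernel of the induced map of the free product is generated by the conjugates of the other factors
  by that factor. In a word, the letters with index \<open>i\<^sub>0\<close> are removed and each other letter is tagged
  with the image under \<open>\<pi>\<close> of the product of the removed letters preceding it.
\<close>

primrec tag_word ::
  "nat monoid \<Rightarrow> ('d \<Rightarrow> nat) \<Rightarrow> nat \<Rightarrow> nat \<Rightarrow> (nat \<times> 'd) list \<Rightarrow> (nat \<times> 'd) list"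
  where "tag_word P \<pi> i\<^sub>0 h [] = []"
  | "tag_word P \<pi> i\<^sub>0 h (a # w) = (if fst a = i\<^sub>0 then tag_word P \<pi> i\<^sub>0 (h \<otimes>\<^bsub>P\<^esub> \<pi> (snd a)) w
      else (prod_encode (fst a, h), snd a) # tag_word P \<pi> i\<^sub>0 h w)"

lemma length_tag_word: "length (tag_word P \<pi> i\<^sub>0 h w) \<le> length w"
  by (induction w arbitrary: h) (auto simp: le_SucI)

lemma snd_tag_word: "snd ` set (tag_word P \<pi> i\<^sub>0 h w) \<subseteq> snd ` set w"
proof (induction w arbitrary: h)
  case (Cons a w)
  show ?case
    using Cons.IH[of h] Cons.IH[of "h \<otimes>\<^bsub>P\<^esub> \<pi> (snd a)"] by auto
qed simp

text \<open>Two neighbours in the tagged word were either neighbours before, with distinct first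
  indices, or separated by exactly one removed letter. In the second case that letter has a
  nontrivial image under \<pi>, so the tags differ. Pairs of index and tag are coded as natural
  numbers so that tagging can be iterated.\<close>

lemma successively_tag_word:
  assumes "group P" "\<pi> \<in> hom D P"
    and "\<And>a. a \<in> set w \<Longrightarrow> snd a \<in> carrier D"
    and "\<And>a. a \<in> set w \<Longrightarrow> fst a = i\<^sub>0 \<Longrightarrow> \<pi> (snd a) \<noteq> \<one>\<^bsub>P\<^esub>"
    and "successively (\<lambda>a b. fst a \<noteq> fst b) w" "h \<in> carrier P"
  shows "successively (\<lambda>a b. fst a \<noteq> fst b) (tag_word P \<pi> i\<^sub>0 h w)"
  using assms(3-)
proof (induction w arbitrary: h)
  case Nil
  then show ?case by simp
next
  case (Cons a w)
  interpret P: group P by fact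
  have a: "\<pi> (snd a) \<in> carrier P"
    using Cons.prems(1) hom_in_carrier[OF assms(2)] by simp
  have succ: "successively (\<lambda>a b. fst a \<noteq> fst b) w"
    using Cons.prems(3) by (auto simp: successively_Cons)
  have IH: "successively (\<lambda>a b. fst a \<noteq> fst b) (tag_word P \<pi> i\<^sub>0 h w)" if "h \<in> carrier P" for h
    using Cons.prems by (intro Cons.IH succ that) auto
  show ?case
  proof (cases "fst a = i\<^sub>0")
    case True
    then show ?thesis using IH a Cons.prems(4) by simp
  next
    case False
    have "fst (hd (tag_word P \<pi> i\<^sub>0 h w)) \<noteq> prod_encode (fst a, h)"
      if ne: "tag_word P \<pi> i\<^sub>0 h w \<noteq> []"
    proof (cases w)
      case Nil
      then show ?thesis using ne by simp
    next
      case (Cons b w')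
      have ab: "fst b \<noteq> fst a" using Cons.prems(3) \<open>w = b # w'\<close> by auto
      show ?thesis
      proof (cases "fst b = i\<^sub>0")
        case False
        then show ?thesis using \<open>w = b # w'\<close> ab by (auto simp: prod_encode_eq)
      next
        case True
        have b: "\<pi> (snd b) \<in> carrier P" "\<pi> (snd b) \<noteq> \<one>\<^bsub>P\<^esub>"
          using Cons.prems(1,2) True \<open>w = b # w'\<close> hom_in_carrier[OF assms(2)] by auto
        then have h: "h \<otimes>\<^bsub>P\<^esub> \<pi> (snd b) \<noteq> h"
          using P.l_cancel_one[OF Cons.prems(4)] by simp
        \<comment> \<open>The letter after the removed b has another index than b, so it is kept and
          becomes the head of the tagged word.\<close>
        obtain c w'' where c: "w' = c # w''"
          using ne True \<open>w = b # w'\<close> by (cases w') auto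
        then have "fst c \<noteq> i\<^sub>0"
          using Cons.prems(3) \<open>w = b # w'\<close> True by auto
        then show ?thesis using h True c \<open>w = b # w'\<close> by (auto simp: prod_encode_eq)
      qed
    qed
    then show ?thesis
      using False IH[OF Cons.prems(4)] by (auto simp: successively_Cons)
  qed
qed

text \<open>Reading the base coordinate at h follows \<open>tag_word\<close>: a letter of copy i_0
  contributes 1 and moves the position from h to h \<pi>(g), while any other letter contributes the
  value of \<alpha> at the code of its index and h, and leaves the position alone.\<close>

lemma wreath_word_prod:
  fixes i\<^sub>0 :: nat
  assumes "group Q" "group P" "\<pi> \<in> hom D P" "\<And>i. \<alpha> i \<in> hom D Q"
    and "\<And>a. a \<in> set w \<Longrightarrow> snd a \<in> carrier D"
  defines "\<beta> \<equiv> \<lambda>i g. if i = i\<^sub>0 then (\<lambda>h\<in>carrier P. \<one>\<^bsub>Q\<^esub>, \<pi> g)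
    else (\<lambda>h\<in>carrier P. \<alpha> (prod_encode (i, h)) g, \<one>\<^bsub>P\<^esub>)"
  assumes "h \<in> carrier P"
  shows "fst (word_prod (wreath Q P) (map (\<lambda>a. \<beta> (fst a) (snd a)) w)) h =
    word_prod Q (map (\<lambda>a. \<alpha> (fst a) (snd a)) (tag_word P \<pi> i\<^sub>0 h w))"
  using assms(5,7)
proof (induction w arbitrary: h)
  case Nil
  then show ?case by (simp add: wreath_def)
next
  case (Cons a w)
  interpret P: group P by fact
  interpret Q: group Q by fact
  have a: "\<pi> (snd a) \<in> carrier P"
    using Cons.prems(1) hom_in_carrier[OF assms(3)] by simp
  have mult: "fst ((s, x) \<otimes>\<^bsub>wreath Q P\<^esub> u) h = s h \<otimes>\<^bsub>Q\<^esub> fst u (h \<otimes>\<^bsub>P\<^esub> x)" for s x u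
    using Cons.prems(2) by (cases u) (simp add: wreath_def)
  \<comment> \<open>Membership in \<open>Q\<close> is needed to cancel the unit that a removed
    letter contributes.\<close>
  have "set (map (\<lambda>a. \<alpha> (fst a) (snd a)) (tag_word P \<pi> i\<^sub>0 h w)) \<subseteq> carrier Q" for h
  proof -
    have "snd c \<in> carrier D" if "c \<in> set (tag_word P \<pi> i\<^sub>0 h w)" for c
    proof -
      have "snd c \<in> snd ` set w"
        using snd_tag_word[of P \<pi> i\<^sub>0 h w] that by blast
      then show ?thesis
        using Cons.prems(1) by (metis imageE list.set_intros(2))
    qed
    then show ?thesis
      using hom_in_carrier[OF assms(4)] by auto
  qed
  then have closed: "word_prod Q (map (\<lambda>a. \<alpha> (fst a) (snd a)) (tag_word P \<pi> i\<^sub>0 h w)) \<in> carrier Q" for h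
    by (rule Q.word_prod_closed)
  have IH: "fst (word_prod (wreath Q P) (map (\<lambda>a. \<beta> (fst a) (snd a)) w)) h =
      word_prod Q (map (\<lambda>a. \<alpha> (fst a) (snd a)) (tag_word P \<pi> i\<^sub>0 h w))" if "h \<in> carrier P" for h
    using Cons.prems(1) that by (intro Cons.IH) auto
  show ?case
  proof (cases "fst a = i\<^sub>0")
    case True
    then show ?thesis
      using Cons.prems(2) a closed by (simp add: \<beta>_def[abs_def] mult IH[unfolded \<beta>_def[abs_def]])
  next
    case False
    then show ?thesis
      using Cons.prems(2) by (simp add: \<beta>_def[abs_def] mult IH[unfolded \<beta>_def[abs_def]])
  qed
qed

text \<open>The family \<alpha> stands for a homomorphism from the free product of copies of
  \<open>D\<close> indexed by the natural numbers; w is a reduced word in it. Tagging with respect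
  to the copy of the first letter shortens w and keeps it reduced, and the wreath product carries
  separation back.\<close>

lemma separate_word_of_copies:
  fixes w :: "(nat \<times> 'd) list"
  assumes "finite_root_class N" "group D" "residually_in N D"
    and "w \<noteq> []" "successively (\<lambda>a b. fst a \<noteq> fst b) w"
    and "\<And>a. a \<in> set w \<Longrightarrow> snd a \<in> carrier D - {\<one>\<^bsub>D\<^esub>}"
  shows "\<exists>(Q :: nat monoid) \<alpha>. finite_group_in N Q \<and> (\<forall>i. \<alpha> i \<in> hom D Q) \<and>
    word_prod Q (map (\<lambda>a. \<alpha> (fst a) (snd a)) w) \<noteq> \<one>\<^bsub>Q\<^esub>"
  using assms(4-)
proof (induction "length w" arbitrary: w rule: less_induct)
  case less
  obtain a w' where w: "w = a # w'" using less.prems(1) by (cases w) auto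
  show ?case
  proof (cases w')
    case Nil
    \<comment> \<open>Tagging a one-letter word would leave nothing, so this case uses residuality
      of \<open>D\<close> directly.\<close>
    obtain Q :: "nat monoid" and \<psi> where
      Q: "finite_group_in N Q" "\<psi> \<in> hom D Q" "\<psi> (snd a) \<noteq> \<one>\<^bsub>Q\<^esub>"
      using assms(3) less.prems(3)[of a] w by (auto simp: residually_in_def)
    moreover have "\<psi> (snd a) \<in> carrier Q"
      using less.prems(3)[of a] w hom_in_carrier[OF Q(2)] by simp
    ultimately show ?thesis
      using w Nil by (intro exI[of _ Q] exI[of _ "\<lambda>_. \<psi>"])
        (simp add: finite_group_in_def group.is_monoid monoid.r_one)
  next
    case (Cons b w'')
    then have ab: "fst b \<noteq> fst a" using less.prems(2) w by auto
    \<comment> \<open>All letters of w are kept alive in \<open>P\<close>, in particular those that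
      will be removed.\<close>
    have "finite (snd ` set w)" "snd ` set w \<subseteq> carrier D - {\<one>\<^bsub>D\<^esub>}"
      using less.prems(3) by auto
    then obtain P :: "nat monoid" and \<pi> where
      P: "finite_group_in N P" "\<pi> \<in> hom D P" "\<forall>g\<in>snd ` set w. \<pi> g \<noteq> \<one>\<^bsub>P\<^esub>"
      using residually_in_finite_set[OF assms(1,3,2)] by metis
    interpret P: group P using P(1) by (simp add: finite_group_in_def)
    let ?w = "tag_word P \<pi> (fst a) \<one>\<^bsub>P\<^esub> w"
    have "\<exists>(Q :: nat monoid) \<alpha>. finite_group_in N Q \<and> (\<forall>i. \<alpha> i \<in> hom D Q) \<and>
      word_prod Q (map (\<lambda>c. \<alpha> (fst c) (snd c)) ?w) \<noteq> \<one>\<^bsub>Q\<^esub>"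
    proof (rule less.hyps)
      show "length ?w < length w"
        using w length_tag_word[of P \<pi> "fst a"] by (simp add: less_Suc_eq_le)
      \<comment> \<open>The second letter has another index than the first and survives the
        removal.\<close>
      show "?w \<noteq> []" using w Cons ab by simp
      show "successively (\<lambda>a b. fst a \<noteq> fst b) ?w"
        using less.prems P(2,3) by (intro successively_tag_word[of P \<pi> D] P.group_axioms) auto
      show "snd c \<in> carrier D - {\<one>\<^bsub>D\<^esub>}" if "c \<in> set ?w" for c
      proof -
        have "snd c \<in> snd ` set w"
          using snd_tag_word[of P \<pi> "fst a" "\<one>\<^bsub>P\<^esub>" w] that by blast
        then show ?thesis
          using less.prems(3) by (metis imageE)
      qed
    qed
    then obtain Q :: "nat monoid" and \<alpha> where
      Q: "finite_group_in N Q" "\<And>i. \<alpha> i \<in> hom D Q"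
        "word_prod Q (map (\<lambda>c. \<alpha> (fst c) (snd c)) ?w) \<noteq> \<one>\<^bsub>Q\<^esub>"
      by blast
    interpret Q: group Q using Q(1) by (simp add: finite_group_in_def)
    let ?W = "wreath Q P"
    \<comment> \<open>The removed copy maps to the top group by \<pi>. Any other copy i maps to the
      base group, with coordinate h given by \<alpha> at the code of (i, h).\<close>
    define \<beta> where "\<beta> = (\<lambda>i g. if i = fst a then (\<lambda>h\<in>carrier P. \<one>\<^bsub>Q\<^esub>, \<pi> g)
      else (\<lambda>h\<in>carrier P. \<alpha> (prod_encode (i, h)) g, \<one>\<^bsub>P\<^esub>))"
    have \<alpha>_closed: "\<alpha> i g \<in> carrier Q" if "g \<in> carrier D" for i g
      by (rule hom_in_carrier[OF Q(2) that])
    have \<pi>_closed: "\<pi> g \<in> carrier P" if "g \<in> carrier D" for g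
      by (rule hom_in_carrier[OF P(2) that])
    have \<beta>_hom: "\<beta> i \<in> hom D ?W" for i
      using Q(2) P(2) by (auto simp: \<beta>_def wreath_def hom_mult \<alpha>_closed \<pi>_closed intro!: homI restrict_ext)
    let ?u = "word_prod ?W (map (\<lambda>c. \<beta> (fst c) (snd c)) w)"
    have "fst ?u \<one>\<^bsub>P\<^esub> = word_prod Q (map (\<lambda>c. \<alpha> (fst c) (snd c)) ?w)"
      unfolding \<beta>_def
      by (rule wreath_word_prod[OF Q.group_axioms P.group_axioms P(2) Q(2)])
        (use less.prems(3) in auto)
    then have "fst ?u \<one>\<^bsub>P\<^esub> \<noteq> \<one>\<^bsub>Q\<^esub>"
      using Q(3) by simp
    then have u: "?u \<noteq> \<one>\<^bsub>?W\<^esub>"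
      by (auto simp: wreath_def)
    have W: "finite_group_in N ?W"
      using wreath_finite_group_in[OF assms(1) Q(1) P(1)] .
    then interpret W: group ?W by (simp add: finite_group_in_def)
    have letters: "set (map (\<lambda>c. \<beta> (fst c) (snd c)) w) \<subseteq> carrier ?W"
      using less.prems(3) hom_in_carrier[OF \<beta>_hom] by auto
    obtain R :: "nat monoid" and i where
      R: "finite_group_in N R" "i \<in> hom ?W R" "inj_on i (carrier ?W)"
      using finite_group_in_nat[OF W] by blast
    interpret R: group R using R(1) by (simp add: finite_group_in_def)
    have "i ?u \<noteq> \<one>\<^bsub>R\<^esub>"
      using hom_neq_one[OF W.group_axioms R.group_axioms R(2,3) W.word_prod_closed[OF letters] u] .
    then have "word_prod R (map (\<lambda>c. (i \<circ> \<beta> (fst c)) (snd c)) w) \<noteq> \<one>\<^bsub>R\<^esub>"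
      using word_prod_hom[OF W.group_axioms R.group_axioms R(2) letters] by (simp add: comp_def)
    moreover have "i \<circ> \<beta> j \<in> hom D R" for j
      using hom_compose[OF \<beta>_hom R(2)] .
    ultimately show ?thesis
      using R(1) by (intro exI[of _ R] exI[of _ "\<lambda>j. i \<circ> \<beta> j"]) blast
  qed
qed

section \<open>Retractions\<close>

text \<open>The retraction sends y f to y. It is multiplicative because F is normal: y f y' f' = (y
  y') (y'^-1 f y') f'.\<close>

lemma (in group) retract_of_retraction:
  assumes "retract_of Y G"
  obtains \<rho> where "\<rho> \<in> hom G G" "\<And>x. x \<in> carrier G \<Longrightarrow> \<rho> x \<in> Y" "\<And>y. y \<in> Y \<Longrightarrow> \<rho> y = y"
proof -
  obtain F where Y: "subgroup Y G" and F: "F \<lhd> G"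
    and YF: "carrier G = Y <#> F" "Y \<inter> F = {\<one>}"
    using assms by (auto simp: retract_of_def)
  interpret Y: subgroup Y G by fact
  interpret F: normal F G by fact
  define \<rho> where "\<rho> x = (THE y. y \<in> Y \<and> (\<exists>f\<in>F. x = y \<otimes> f))" for x
  have \<rho>: "\<rho> (y \<otimes> f) = y" if yf: "y \<in> Y" "f \<in> F" for y f
    unfolding \<rho>_def
  proof (rule the_equality)
    show "y \<in> Y \<and> (\<exists>f'\<in>F. y \<otimes> f = y \<otimes> f')" using yf by blast
    fix y' assume "y' \<in> Y \<and> (\<exists>f'\<in>F. y \<otimes> f = y' \<otimes> f')"
    then obtain f' where y': "y' \<in> Y" "f' \<in> F" "y \<otimes> f = y' \<otimes> f'" by blast
    \<comment> \<open>Equality of y f and y' f' puts y'^-1 y into both Y and F, hence it is 1 and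
      the description determines y.\<close>
    have "inv y' \<otimes> y = inv y' \<otimes> (y \<otimes> f) \<otimes> inv f"
      using yf y'(1,2) by (simp add: m_assoc)
    also have "\<dots> = f' \<otimes> inv f"
      using yf y'(1,2) by (simp add: y'(3) flip: m_assoc)
    finally have eq: "inv y' \<otimes> y = f' \<otimes> inv f" .
    have "inv y' \<otimes> y \<in> Y" using yf y' by simp
    moreover have "inv y' \<otimes> y \<in> F" using yf y' by (simp add: eq)
    ultimately have "inv y' \<otimes> y = \<one>" using YF(2) by blast
    then show "y' = y" using yf y'(1) by (metis Y.mem_carrier inv_equality inv_inv inv_closed)
  qed
  have decomp: "\<exists>y\<in>Y. \<exists>f\<in>F. x = y \<otimes> f" if "x \<in> carrier G" for x
    using that YF(1) by (auto simp: set_mult_def)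
  show thesis
  proof
    show "\<rho> x \<in> Y" if "x \<in> carrier G" for x
      using decomp[OF that] \<rho> by auto
    show "\<rho> y = y" if "y \<in> Y" for y
      using \<rho>[OF that F.one_closed] that by simp
    show "\<rho> \<in> hom G G"
    proof (rule homI)
      show "\<rho> x \<in> carrier G" if "x \<in> carrier G" for x
        using decomp[OF that] \<rho> by auto
      fix x x' assume "x \<in> carrier G" "x' \<in> carrier G"
      then obtain y f y' f' where
        x: "y \<in> Y" "f \<in> F" "x = y \<otimes> f" and x': "y' \<in> Y" "f' \<in> F" "x' = y' \<otimes> f'"
        using decomp by metis
      have "inv y' \<otimes> f \<otimes> y' \<in> F"
        using F.inv_op_closed1 x(2) x'(1) by simp
      then have "\<rho> ((y \<otimes> y') \<otimes> (inv y' \<otimes> f \<otimes> y' \<otimes> f')) = y \<otimes> y'"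
        using x x' by (intro \<rho>) auto
      moreover have "(y \<otimes> y') \<otimes> (inv y' \<otimes> f \<otimes> y' \<otimes> f') = x \<otimes> x'"
        using x x' by (simp add: m_assoc) (simp flip: m_assoc)
      ultimately show "\<rho> (x \<otimes> x') = \<rho> x \<otimes> \<rho> x'"
        using x x' \<rho> by simp
    qed
  qed
qed

section \<open>The amalgamated product by words\<close>

text \<open>The composite of the two quotient maps, from words to the free product and from there to
  the amalgamated product.\<close>

definition amalg_class ::
  "('a, 'm) monoid_scheme \<Rightarrow> ('b, 'n) monoid_scheme \<Rightarrow> 'a set \<Rightarrow> ('a \<Rightarrow> 'b) \<Rightarrow> ('a + 'b) list
    \<Rightarrow> ('a + 'b) list set set"
  where "amalg_class A B H \<phi> w =
    normal_closure (free_product A B)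
      {inv\<^bsub>free_product A B\<^esub> (fp_inl A B h) \<otimes>\<^bsub>free_product A B\<^esub> fp_inr A B (\<phi> h) |h. h \<in> H}
    #>\<^bsub>free_product A B\<^esub> fp_class A B w"

locale amalgam =
  A: group A + B: group B
  for A :: "('a, 'm) monoid_scheme" and B :: "('b, 'n) monoid_scheme" +
  fixes H :: "'a set" and \<phi> :: "'a \<Rightarrow> 'b"
  assumes H_subset: "H \<subseteq> carrier A" and \<phi>_closed: "h \<in> H \<Longrightarrow> \<phi> h \<in> carrier B"
begin

abbreviation "P \<equiv> free_product A B"

abbreviation "G \<equiv> amalgamated_product A B H \<phi>"

abbreviation "cls \<equiv> amalg_class A B H \<phi>"

definition "relators = {inv\<^bsub>P\<^esub> (fp_inl A B h) \<otimes>\<^bsub>P\<^esub> fp_inr A B (\<phi> h) |h. h \<in> H}"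

lemma group_P: "group P"
  by (rule group_free_product) unfold_locales

lemma group_G: "group G"
  using H_subset \<phi>_closed by (intro group_amalgamated_product) (unfold_locales, auto)

lemma fp_class_closed: "w \<in> fp_words A B \<Longrightarrow> fp_class A B w \<in> carrier P"
  by (simp add: free_product_def)

lemma inl_closed: "a \<in> carrier A \<Longrightarrow> fp_inl A B a \<in> carrier P"
  by (rule hom_in_carrier[OF fp_inl_hom])

lemma inr_closed: "b \<in> carrier B \<Longrightarrow> fp_inr A B b \<in> carrier P"
  by (rule hom_in_carrier[OF fp_inr_hom])

lemma relators_subset: "relators \<subseteq> carrier P"
proof -
  interpret P: group P by (rule group_P)
  show ?thesis
    using H_subset by (auto simp: relators_def inl_closed inr_closed \<phi>_closed)
qed

lemma normal_relators: "normal_closure P relators \<lhd> P"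
  using group.normal_closure_normal[OF group_P relators_subset] .

lemma G_eq: "G = P Mod normal_closure P relators"
  by (simp add: amalgamated_product_def relators_def)

lemma cls_eq: "cls w = normal_closure P relators #>\<^bsub>P\<^esub> fp_class A B w"
  by (simp add: amalg_class_def relators_def)

lemma cls_surj: "g \<in> carrier G \<Longrightarrow> \<exists>w\<in>fp_words A B. g = cls w"
  by (auto simp: G_eq cls_eq FactGroup_def RCOSETS_def free_product_def)

lemma proj_hom: "(\<lambda>x. normal_closure P relators #>\<^bsub>P\<^esub> x) \<in> hom P G"
  unfolding G_eq by (rule normal.r_coset_hom_Mod[OF normal_relators])

lemma cls_closed: "w \<in> fp_words A B \<Longrightarrow> cls w \<in> carrier G"
  using hom_in_carrier[OF proj_hom fp_class_closed] by (simp add: cls_eq)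

lemma cls_append:
  assumes "u \<in> fp_words A B" "v \<in> fp_words A B"
  shows "cls (u @ v) = cls u \<otimes>\<^bsub>G\<^esub> cls v"
  using hom_mult[OF proj_hom fp_class_closed[OF assms(1)] fp_class_closed[OF assms(2)]]
  by (simp add: cls_eq fp_mult_class[OF assms])

lemma cls_cong: "fp_eq A B u v \<Longrightarrow> cls u = cls v"
proof -
  assume "fp_eq A B u v"
  then have "fp_class A B u = fp_class A B v"
    by (auto simp: fp_class_def intro: fp_eq.sym fp_eq.trans)
  then show ?thesis
    by (simp add: cls_eq)
qed

lemma cls_Nil: "cls [] = \<one>\<^bsub>G\<^esub>"
  using hom_one[OF proj_hom group_P group_G] by (simp add: cls_eq free_product_def)

text \<open>With x, y the images of h and \<phi> h in the free product, y = x (x^-1 y), and the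
  second factor is a relator.\<close>

lemma cls_amalgamate:
  assumes "h \<in> H"
  shows "cls [Inl h] = cls [Inr (\<phi> h)]"
proof -
  interpret P: group P by (rule group_P)
  interpret N: normal "normal_closure P relators" P by (rule normal_relators)
  interpret G: group G by (rule group_G)
  let ?x = "fp_inl A B h" and ?y = "fp_inr A B (\<phi> h)" and ?\<pi> = "\<lambda>x. normal_closure P relators #>\<^bsub>P\<^esub> x"
  have x: "?x \<in> carrier P" and y: "?y \<in> carrier P"
    using assms H_subset by (auto simp: inl_closed inr_closed \<phi>_closed)
  have "inv\<^bsub>P\<^esub> ?x \<otimes>\<^bsub>P\<^esub> ?y \<in> relators"
    using assms by (auto simp: relators_def)
  then have "inv\<^bsub>P\<^esub> ?x \<otimes>\<^bsub>P\<^esub> ?y \<in> normal_closure P relators"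
    by (auto simp: normal_closure_def)
  then have "?\<pi> (inv\<^bsub>P\<^esub> ?x \<otimes>\<^bsub>P\<^esub> ?y) = \<one>\<^bsub>G\<^esub>"
    using N.rcos_const[OF P.is_group] by (simp add: G_eq FactGroup_def)
  then have "?\<pi> (?x \<otimes>\<^bsub>P\<^esub> (inv\<^bsub>P\<^esub> ?x \<otimes>\<^bsub>P\<^esub> ?y)) = ?\<pi> ?x"
    using hom_mult[OF proj_hom x, of "inv\<^bsub>P\<^esub> ?x \<otimes>\<^bsub>P\<^esub> ?y"] hom_in_carrier[OF proj_hom x] x y by simp
  then show ?thesis
    using x y by (simp add: cls_eq fp_inl_def fp_inr_def flip: P.m_assoc)
qed

text \<open>The universal property of the amalgamated product, with the value on words made explicit
  because all later computations take place on words.\<close>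

lemma amalgam_extend:
  assumes "group Q" "\<alpha> \<in> hom A Q" "\<beta> \<in> hom B Q" "\<And>h. h \<in> H \<Longrightarrow> \<alpha> h = \<beta> (\<phi> h)"
  obtains \<Psi> where "\<Psi> \<in> hom G Q"
    "\<And>w. w \<in> fp_words A B \<Longrightarrow> \<Psi> (cls w) = word_prod Q (map (case_sum \<alpha> \<beta>) w)"
proof -
  interpret P: group P by (rule group_P)
  interpret Q: group Q by fact
  obtain k where k: "k \<in> hom P Q" "\<forall>x\<in>carrier A. k (fp_inl A B x) = \<alpha> x"
      "\<forall>y\<in>carrier B. k (fp_inr A B y) = \<beta> y"
    using free_product_extend[OF A.is_group B.is_group assms(1-3)] by blast
  interpret k: group_hom P Q k
    using k(1) by unfold_locales
  have "r \<in> kernel P Q k" if r: "r \<in> relators" for r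
  proof -
    obtain h where h: "h \<in> H" "r = inv\<^bsub>P\<^esub> (fp_inl A B h) \<otimes>\<^bsub>P\<^esub> fp_inr A B (\<phi> h)"
      using r by (auto simp: relators_def)
    have carr: "h \<in> carrier A" "\<phi> h \<in> carrier B" using h H_subset \<phi>_closed by auto
    have x: "fp_inl A B h \<in> carrier P" and y: "fp_inr A B (\<phi> h) \<in> carrier P"
      using carr by (auto simp: inl_closed inr_closed)
    have "k r = inv\<^bsub>Q\<^esub> (\<alpha> h) \<otimes>\<^bsub>Q\<^esub> \<beta> (\<phi> h)"
      using x y carr k by (simp add: h(2))
    also have "\<dots> = \<one>\<^bsub>Q\<^esub>"
      using assms(4)[OF h(1)] hom_in_carrier[OF assms(3) carr(2)] by simp
    finally show ?thesis
      using r relators_subset by (auto simp: kernel_def)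
  qed
  \<comment> \<open>The kernel is one of the normal subgroups whose intersection is the normal
    closure.\<close>
  then have "normal_closure P relators \<subseteq> kernel P Q k"
    using k.normal_kernel by (auto simp: normal_closure_def)
  then obtain \<Psi> where \<Psi>: "\<Psi> \<in> hom G Q"
      "\<And>x. x \<in> carrier P \<Longrightarrow> \<Psi> (normal_closure P relators #>\<^bsub>P\<^esub> x) = k x"
    using k.FactGroup_universal_kernel[OF normal_relators] unfolding G_eq by blast
  have "k (fp_class A B w) = word_prod Q (map (case_sum \<alpha> \<beta>) w)" if "w \<in> fp_words A B" for w
    using that
  proof (induction w)
    case Nil
    then show ?case using k.hom_one by (simp add: free_product_def)
  next
    case (Cons x w)
    then have w: "w \<in> fp_words A B" and x: "[x] \<in> fp_words A B" by (auto simp: fp_words_def)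
    have "k (fp_class A B [x]) = case_sum \<alpha> \<beta> x"
      using k(2,3) x by (auto simp: fp_words_def fp_inl_def fp_inr_def)
    moreover have "k (fp_class A B ([x] @ w)) = k (fp_class A B [x]) \<otimes>\<^bsub>Q\<^esub> k (fp_class A B w)"
      using k.hom_mult[OF fp_class_closed[OF x] fp_class_closed[OF w]]
      unfolding fp_mult_class[OF x w] .
    ultimately show ?case using Cons.IH[OF w] by simp
  qed
  then show thesis
    using that \<Psi> fp_class_closed by (simp add: cls_eq)
qed

end

text \<open>A letter is put in front of an already reduced word: it is dropped, prepended, or merged
  with a first letter from the same factor. Subgroups \<open>U\<close> and \<open>V\<close> appear
  so that merging keeps the letters inside the kernels F_A and F_B.\<close>

lemma reduce_word:
  assumes "group A" "group B" "subgroup U A" "subgroup V B" "w \<in> lists (U <+> V)"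
  shows "\<exists>v\<in>lists (U <+> V). fp_eq A B w v \<and> successively (\<lambda>x y. isl x \<noteq> isl y) v \<and>
    Inl \<one>\<^bsub>A\<^esub> \<notin> set v \<and> Inr \<one>\<^bsub>B\<^esub> \<notin> set v"
  using assms(5)
proof (induction w)
  case Nil
  then show ?case by (intro bexI[of _ "[]"]) (auto intro: fp_eq.refl simp: fp_words_def)
next
  case (Cons x w)
  interpret U: subgroup U A by fact
  interpret V: subgroup V B by fact
  have words: "u \<in> fp_words A B" if "u \<in> lists (U <+> V)" for u
    using that U.subset V.subset by (auto simp: fp_words_def)
  obtain v where v: "v \<in> lists (U <+> V)" "fp_eq A B w v"
      "successively (\<lambda>x y. isl x \<noteq> isl y) v" "Inl \<one>\<^bsub>A\<^esub> \<notin> set v" "Inr \<one>\<^bsub>B\<^esub> \<notin> set v"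
    using Cons by auto
  have x: "x \<in> U <+> V" using Cons.hyps by simp
  have app: "fp_eq A B (s @ u) (t @ u)" if "fp_eq A B s t" "u \<in> lists (U <+> V)" for s t u
    using that words by (intro fp_eq.append fp_eq.refl) auto
  have xv: "fp_eq A B (x # w) (x # v)"
    using fp_eq.append[OF fp_eq.refl[OF words[of "[x]"]] v(2)] x by simp
  show ?case
  proof (cases "x = Inl \<one>\<^bsub>A\<^esub> \<or> x = Inr \<one>\<^bsub>B\<^esub>")
    case True
    then have "fp_eq A B (x # v) v"
      using app[OF fp_eq.one_left v(1)] app[OF fp_eq.one_right v(1)] by auto
    then show ?thesis using v xv fp_eq.trans by blast
  next
    case x1: False
    show ?thesis
    proof (cases "v \<noteq> [] \<and> isl (hd v) = isl x")
      case False
      then have "successively (\<lambda>x y. isl x \<noteq> isl y) (x # v)"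
        using v(3) by (auto simp: successively_Cons)
      then show ?thesis
        using v xv x x1 by (intro bexI[of _ "x # v"]) auto
    next
      case True
      then obtain y u where yu: "v = y # u" "isl y = isl x" by (cases v) auto
      have u: "u \<in> lists (U <+> V)" "y \<in> U <+> V" "successively (\<lambda>x y. isl x \<noteq> isl y) u"
        using v(1,3) yu by (auto simp: successively_Cons)
      obtain z where z: "z \<in> U <+> V" "fp_eq A B [x, y] [z]" "isl z = isl y"
      proof (cases x)
        case (Inl a)
        then obtain b where b: "y = Inl b" using yu(2) by (cases y) auto
        then have ab: "a \<in> U" "b \<in> U" using Inl x u(2) by auto
        then have "Inl (a \<otimes>\<^bsub>A\<^esub> b) \<in> U <+> V" by auto
        then show ?thesis
          using that[of "Inl (a \<otimes>\<^bsub>A\<^esub> b)"] fp_eq.mult_left[of a A b B] Inl b ab by simp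
      next
        case (Inr a)
        then obtain b where b: "y = Inr b" using yu(2) by (cases y) auto
        then have ab: "a \<in> V" "b \<in> V" using Inr x u(2) by auto
        then have "Inr (a \<otimes>\<^bsub>B\<^esub> b) \<in> U <+> V" by auto
        then show ?thesis
          using that[of "Inr (a \<otimes>\<^bsub>B\<^esub> b)"] fp_eq.mult_right[of a B b A] Inr b ab by simp
      qed
      have wz: "fp_eq A B (x # w) (z # u)"
        using fp_eq.trans[OF xv] app[OF z(2) u(1)] yu by simp
      show ?thesis
      \<comment> \<open>If the merged letter is trivial, what remains is a tail of the old reduced
        word, so no further merging is triggered.\<close>
      proof (cases "z = Inl \<one>\<^bsub>A\<^esub> \<or> z = Inr \<one>\<^bsub>B\<^esub>")
        case True
        then have "fp_eq A B (z # u) u"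
          using app[OF fp_eq.one_left u(1)] app[OF fp_eq.one_right u(1)] by auto
        then have "fp_eq A B (x # w) u"
          using wz fp_eq.trans by metis
        then show ?thesis
          using u v(4,5) yu by (intro bexI[of _ u]) auto
      next
        case False
        have "successively (\<lambda>x y. isl x \<noteq> isl y) (z # u)"
          using v(3) yu z(3) by (auto simp: successively_Cons)
        then show ?thesis
          using False wz u v(4,5) yu z(1) by (intro bexI[of _ "z # u"]) auto
      qed
    qed
  qed
qed

section \<open>Amalgamation along retracts\<close>

text \<open>
  The map is \<open>a \<mapsto> (s \<mapsto> \<alpha> a, \<sigma> a)\<close>, with constant first component, conjugated by \<open>(q, \<one>)\<close>.
\<close>

lemma wreath_conjugate_hom:
  assumes "group A" "group Q" "group S" "\<alpha> \<in> hom A Q" "\<sigma> \<in> hom A S"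
    and "q \<in> carrier S \<rightarrow> carrier Q"
  shows "(\<lambda>a. (\<lambda>s\<in>carrier S. q s \<otimes>\<^bsub>Q\<^esub> \<alpha> a \<otimes>\<^bsub>Q\<^esub> inv\<^bsub>Q\<^esub> q (s \<otimes>\<^bsub>S\<^esub> \<sigma> a), \<sigma> a)) \<in> hom A (wreath Q S)"
proof (rule homI)
  interpret A: group A by fact
  interpret Q: group Q by fact
  interpret S: group S by fact
  have closed: "\<alpha> a \<in> carrier Q" "\<sigma> a \<in> carrier S" if "a \<in> carrier A" for a
    using hom_in_carrier[OF assms(4) that] hom_in_carrier[OF assms(5) that] .
  have q: "q s \<in> carrier Q" if "s \<in> carrier S" for s
    using assms(6) that by blast
  fix a assume a: "a \<in> carrier A"
  show "(\<lambda>s\<in>carrier S. q s \<otimes>\<^bsub>Q\<^esub> \<alpha> a \<otimes>\<^bsub>Q\<^esub> inv\<^bsub>Q\<^esub> q (s \<otimes>\<^bsub>S\<^esub> \<sigma> a), \<sigma> a) \<in> carrier (wreath Q S)"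
    using a by (simp add: wreath_def closed q)
  fix b assume b: "b \<in> carrier A"
  \<comment> \<open>The values of q telescope: the inverse closing the first factor cancels against
    the start of the second, both taken at s \<sigma>(a).\<close>
  have "q s \<otimes>\<^bsub>Q\<^esub> \<alpha> (a \<otimes>\<^bsub>A\<^esub> b) \<otimes>\<^bsub>Q\<^esub> inv\<^bsub>Q\<^esub> q (s \<otimes>\<^bsub>S\<^esub> \<sigma> (a \<otimes>\<^bsub>A\<^esub> b)) =
      (q s \<otimes>\<^bsub>Q\<^esub> \<alpha> a \<otimes>\<^bsub>Q\<^esub> inv\<^bsub>Q\<^esub> q (s \<otimes>\<^bsub>S\<^esub> \<sigma> a)) \<otimes>\<^bsub>Q\<^esub>
      (q (s \<otimes>\<^bsub>S\<^esub> \<sigma> a) \<otimes>\<^bsub>Q\<^esub> \<alpha> b \<otimes>\<^bsub>Q\<^esub> inv\<^bsub>Q\<^esub> q (s \<otimes>\<^bsub>S\<^esub> \<sigma> a \<otimes>\<^bsub>S\<^esub> \<sigma> b))" if s: "s \<in> carrier S" for s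
  proof -
    define u v where "u = q (s \<otimes>\<^bsub>S\<^esub> \<sigma> a)" and "v = q (s \<otimes>\<^bsub>S\<^esub> \<sigma> a \<otimes>\<^bsub>S\<^esub> \<sigma> b)"
    have uv: "u \<in> carrier Q" "v \<in> carrier Q" using a b s by (simp_all add: u_def v_def closed q)
    have c: "inv\<^bsub>Q\<^esub> u \<otimes>\<^bsub>Q\<^esub> (u \<otimes>\<^bsub>Q\<^esub> x) = x" if "x \<in> carrier Q" for x
      using uv that by (simp flip: Q.m_assoc)
    show ?thesis
      using a b s uv
      by (simp add: hom_mult[OF assms(4)] hom_mult[OF assms(5)] closed q S.m_assoc[symmetric]
          Q.m_assoc c flip: u_def v_def)
  qed
  then show "(\<lambda>s\<in>carrier S. q s \<otimes>\<^bsub>Q\<^esub> \<alpha> (a \<otimes>\<^bsub>A\<^esub> b) \<otimes>\<^bsub>Q\<^esub> inv\<^bsub>Q\<^esub> q (s \<otimes>\<^bsub>S\<^esub> \<sigma> (a \<otimes>\<^bsub>A\<^esub> b)), \<sigma> (a \<otimes>\<^bsub>A\<^esub> b)) =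
      (\<lambda>s\<in>carrier S. q s \<otimes>\<^bsub>Q\<^esub> \<alpha> a \<otimes>\<^bsub>Q\<^esub> inv\<^bsub>Q\<^esub> q (s \<otimes>\<^bsub>S\<^esub> \<sigma> a), \<sigma> a) \<otimes>\<^bsub>wreath Q S\<^esub>
      (\<lambda>s\<in>carrier S. q s \<otimes>\<^bsub>Q\<^esub> \<alpha> b \<otimes>\<^bsub>Q\<^esub> inv\<^bsub>Q\<^esub> q (s \<otimes>\<^bsub>S\<^esub> \<sigma> b), \<sigma> b)"
    using a b by (auto simp: wreath_def closed hom_mult[OF assms(5)] intro!: restrict_ext)
qed

text \<open>The retracts enter through their retractions, and \<psi> is the inverse of \<phi>. This
  makes the maps between \<open>A\<close> and \<open>B\<close> that pass through H = K
  available.\<close>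

locale retract_amalgam = amalgam A B H \<phi>
  for A :: "('a, 'm) monoid_scheme" and B :: "('b, 'n) monoid_scheme"
    and H :: "'a set" and \<phi> :: "'a \<Rightarrow> 'b" +
  fixes K :: "'b set" and \<psi> :: "'b \<Rightarrow> 'a" and \<rho>\<^sub>A :: "'a \<Rightarrow> 'a" and \<rho>\<^sub>B :: "'b \<Rightarrow> 'b"
  assumes subgroup_H: "subgroup H A" and subgroup_K: "subgroup K B"
    and \<phi>_hom: "\<phi> \<in> hom (A\<lparr>carrier := H\<rparr>) (B\<lparr>carrier := K\<rparr>)"
    and \<psi>_hom: "\<psi> \<in> hom (B\<lparr>carrier := K\<rparr>) (A\<lparr>carrier := H\<rparr>)"
    and \<psi>_\<phi>: "h \<in> H \<Longrightarrow> \<psi> (\<phi> h) = h" and \<phi>_\<psi>: "k \<in> K \<Longrightarrow> \<phi> (\<psi> k) = k"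
    and \<rho>\<^sub>A_hom: "\<rho>\<^sub>A \<in> hom A A" and \<rho>\<^sub>A_mem: "a \<in> carrier A \<Longrightarrow> \<rho>\<^sub>A a \<in> H"
    and \<rho>\<^sub>A_id: "h \<in> H \<Longrightarrow> \<rho>\<^sub>A h = h"
    and \<rho>\<^sub>B_hom: "\<rho>\<^sub>B \<in> hom B B" and \<rho>\<^sub>B_mem: "b \<in> carrier B \<Longrightarrow> \<rho>\<^sub>B b \<in> K"
    and \<rho>\<^sub>B_id: "k \<in> K \<Longrightarrow> \<rho>\<^sub>B k = k"
begin

sublocale H: subgroup H A by (rule subgroup_H)

sublocale K: subgroup K B by (rule subgroup_K)

lemma \<phi>_mem: "h \<in> H \<Longrightarrow> \<phi> h \<in> K"
  using \<phi>_hom by (auto simp: hom_def)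

lemma \<psi>_mem: "k \<in> K \<Longrightarrow> \<psi> k \<in> H"
  using \<psi>_hom by (auto simp: hom_def)

abbreviation "F\<^sub>A \<equiv> kernel A A \<rho>\<^sub>A"

abbreviation "F\<^sub>B \<equiv> kernel B B \<rho>\<^sub>B"

lemma \<phi>_\<rho>\<^sub>A_hom: "(\<lambda>a. \<phi> (\<rho>\<^sub>A a)) \<in> hom A B"
  using \<phi>_hom \<rho>\<^sub>A_hom \<rho>\<^sub>A_mem \<phi>_mem K.subset by (auto simp: hom_def Pi_iff)

lemma \<psi>_\<rho>\<^sub>B_hom: "(\<lambda>b. \<psi> (\<rho>\<^sub>B b)) \<in> hom B A"
  using \<psi>_hom \<rho>\<^sub>B_hom \<rho>\<^sub>B_mem \<psi>_mem H.subset by (auto simp: hom_def Pi_iff)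

sublocale \<rho>\<^sub>A: group_hom A A \<rho>\<^sub>A
  using \<rho>\<^sub>A_hom by unfold_locales

sublocale \<rho>\<^sub>B: group_hom B B \<rho>\<^sub>B
  using \<rho>\<^sub>B_hom by unfold_locales

lemma kernel_words_subset: "lists (F\<^sub>A <+> F\<^sub>B) \<subseteq> fp_words A B"
  by (auto simp: fp_words_def kernel_def intro!: lists_mono)

section \<open>The factors as retracts of the amalgamated product\<close>

text \<open>The identity of \<open>A\<close> and the map
  \<open>\<psi> \<circ> \<rho>\<^sub>B\<close> agree on the amalgamated subgroup. The resulting map
  from \<open>G\<close> to \<open>A\<close> is a left inverse of the canonical map, so
  \<open>A\<close> embeds in \<open>G\<close>.\<close>

lemma residually_in_A:
  assumes "residually_in N G"
  shows "residually_in N A"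
proof -
  have id: "(\<lambda>a. a) \<in> hom A A" by (simp add: hom_def)
  obtain \<Psi> where \<Psi>: "\<Psi> \<in> hom G A"
      "\<And>w. w \<in> fp_words A B \<Longrightarrow> \<Psi> (cls w) = word_prod A (map (case_sum (\<lambda>a. a) (\<lambda>b. \<psi> (\<rho>\<^sub>B b))) w)"
    using amalgam_extend[OF A.is_group id \<psi>_\<rho>\<^sub>B_hom] \<phi>_mem \<rho>\<^sub>B_id \<psi>_\<phi> by metis
  have words: "[Inl a] \<in> fp_words A B" if "a \<in> carrier A" for a
    using that by (auto simp: fp_words_def)
  have "(\<lambda>a. cls [Inl a]) \<in> hom A G"
  proof (rule homI)
    fix a b assume ab: "a \<in> carrier A" "b \<in> carrier A"
    show "cls [Inl a] \<in> carrier G" using cls_closed[OF words[OF ab(1)]] .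
    show "cls [Inl (a \<otimes>\<^bsub>A\<^esub> b)] = cls [Inl a] \<otimes>\<^bsub>G\<^esub> cls [Inl b]"
      using cls_append[OF words[OF ab(1)] words[OF ab(2)]] cls_cong[OF fp_eq.mult_left[OF ab]] by simp
  qed
  moreover have "inj_on (\<lambda>a. cls [Inl a]) (carrier A)"
    by (rule inj_on_inverseI[of _ \<Psi>]) (simp add: \<Psi>(2) words)
  ultimately show ?thesis
    using residually_in_by_embedding[OF assms A.is_group group_G] by blast
qed

lemma residually_in_B:
  assumes "residually_in N G"
  shows "residually_in N B"
proof -
  have id: "(\<lambda>b. b) \<in> hom B B" by (simp add: hom_def)
  obtain \<Psi> where \<Psi>: "\<Psi> \<in> hom G B"
      "\<And>w. w \<in> fp_words A B \<Longrightarrow> \<Psi> (cls w) = word_prod B (map (case_sum (\<lambda>a. \<phi> (\<rho>\<^sub>A a)) (\<lambda>b. b)) w)"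
    using amalgam_extend[OF B.is_group \<phi>_\<rho>\<^sub>A_hom id] \<rho>\<^sub>A_id by metis
  have words: "[Inr b] \<in> fp_words A B" if "b \<in> carrier B" for b
    using that by (auto simp: fp_words_def)
  have "(\<lambda>b. cls [Inr b]) \<in> hom B G"
  proof (rule homI)
    fix a b assume ab: "a \<in> carrier B" "b \<in> carrier B"
    show "cls [Inr a] \<in> carrier G" using cls_closed[OF words[OF ab(1)]] .
    show "cls [Inr (a \<otimes>\<^bsub>B\<^esub> b)] = cls [Inr a] \<otimes>\<^bsub>G\<^esub> cls [Inr b]"
      using cls_append[OF words[OF ab(1)] words[OF ab(2)]] cls_cong[OF fp_eq.mult_right[OF ab]] by simp
  qed
  moreover have "inj_on (\<lambda>b. cls [Inr b]) (carrier B)"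
    by (rule inj_on_inverseI[of _ \<Psi>]) (simp add: \<Psi>(2) words)
  ultimately show ?thesis
    using residually_in_by_embedding[OF assms B.is_group group_G] by blast
qed

section \<open>Elements of the amalgamated product as kernel words times elements of H\<close>

text \<open>A retraction is idempotent, so c times the inverse of its image is killed by it.\<close>

lemma kernel_part_A:
  assumes "c \<in> carrier A"
  shows "c \<otimes>\<^bsub>A\<^esub> inv\<^bsub>A\<^esub> \<rho>\<^sub>A c \<in> F\<^sub>A" "cls [Inl c] = cls [Inl (c \<otimes>\<^bsub>A\<^esub> inv\<^bsub>A\<^esub> \<rho>\<^sub>A c), Inl (\<rho>\<^sub>A c)]"
proof -
  have r: "\<rho>\<^sub>A c \<in> carrier A" using assms by simp
  have idem: "\<rho>\<^sub>A (\<rho>\<^sub>A c) = \<rho>\<^sub>A c" using \<rho>\<^sub>A_id[OF \<rho>\<^sub>A_mem[OF assms]] .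
  show "c \<otimes>\<^bsub>A\<^esub> inv\<^bsub>A\<^esub> \<rho>\<^sub>A c \<in> F\<^sub>A"
    using assms r by (simp add: kernel_def idem)
  have "fp_eq A B [Inl (c \<otimes>\<^bsub>A\<^esub> inv\<^bsub>A\<^esub> \<rho>\<^sub>A c), Inl (\<rho>\<^sub>A c)] [Inl c]"
    using fp_eq.mult_left[of "c \<otimes>\<^bsub>A\<^esub> inv\<^bsub>A\<^esub> \<rho>\<^sub>A c" A "\<rho>\<^sub>A c" B] assms r by (simp add: A.m_assoc)
  then show "cls [Inl c] = cls [Inl (c \<otimes>\<^bsub>A\<^esub> inv\<^bsub>A\<^esub> \<rho>\<^sub>A c), Inl (\<rho>\<^sub>A c)]"
    using cls_cong by metis
qed

lemma kernel_part_B: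
  assumes "c \<in> carrier B"
  shows "c \<otimes>\<^bsub>B\<^esub> inv\<^bsub>B\<^esub> \<rho>\<^sub>B c \<in> F\<^sub>B" "cls [Inr c] = cls [Inr (c \<otimes>\<^bsub>B\<^esub> inv\<^bsub>B\<^esub> \<rho>\<^sub>B c), Inr (\<rho>\<^sub>B c)]"
proof -
  have r: "\<rho>\<^sub>B c \<in> carrier B" using assms by simp
  have idem: "\<rho>\<^sub>B (\<rho>\<^sub>B c) = \<rho>\<^sub>B c" using \<rho>\<^sub>B_id[OF \<rho>\<^sub>B_mem[OF assms]] .
  show "c \<otimes>\<^bsub>B\<^esub> inv\<^bsub>B\<^esub> \<rho>\<^sub>B c \<in> F\<^sub>B"
    using assms r by (simp add: kernel_def idem)
  have "fp_eq A B [Inr (c \<otimes>\<^bsub>B\<^esub> inv\<^bsub>B\<^esub> \<rho>\<^sub>B c), Inr (\<rho>\<^sub>B c)] [Inr c]"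
    using fp_eq.mult_right[of "c \<otimes>\<^bsub>B\<^esub> inv\<^bsub>B\<^esub> \<rho>\<^sub>B c" B "\<rho>\<^sub>B c" A] assms r by (simp add: B.m_assoc)
  then show "cls [Inr c] = cls [Inr (c \<otimes>\<^bsub>B\<^esub> inv\<^bsub>B\<^esub> \<rho>\<^sub>B c), Inr (\<rho>\<^sub>B c)]"
    using cls_cong by metis
qed

text \<open>The word is read from left to right with a pending h in H at the end. The next letter
  absorbs h and is then split into a kernel letter and a new element of H.\<close>

lemma kernel_word_times_H:
  assumes "w \<in> fp_words A B"
  shows "\<exists>v\<in>lists (F\<^sub>A <+> F\<^sub>B). \<exists>h\<in>H. cls w = cls (v @ [Inl h])"
  using assms
proof (induction w rule: rev_induct)
  case Nil
  have "cls [] = cls ([] @ [Inl \<one>\<^bsub>A\<^esub>])"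
    using cls_cong[OF fp_eq.one_left] by simp
  then show ?case using H.one_closed by blast
next
  case (snoc x w)
  then have w: "w \<in> fp_words A B" and x: "[x] \<in> fp_words A B" by (auto simp: fp_words_def)
  obtain v h where v: "v \<in> lists (F\<^sub>A <+> F\<^sub>B)" "h \<in> H" "cls w = cls (v @ [Inl h])"
    using snoc.IH[OF w] by blast
  have vw: "v \<in> fp_words A B" using v(1) kernel_words_subset by blast
  have h: "h \<in> carrier A" "\<phi> h \<in> carrier B" using v(2) \<phi>_closed H.subset by auto
  have letters: "[Inl a] \<in> fp_words A B" "[Inr b] \<in> fp_words A B"
    if "a \<in> carrier A" "b \<in> carrier B" for a b
    using that by (auto simp: fp_words_def)
  have "\<exists>f h'. f \<in> F\<^sub>A <+> F\<^sub>B \<and> h' \<in> H \<and> cls ([Inl h] @ [x]) = cls ([f] @ [Inl h'])"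
  proof (cases x)
    case (Inl a)
    then have a: "a \<in> carrier A" using x by (auto simp: fp_words_def)
    then have c: "h \<otimes>\<^bsub>A\<^esub> a \<in> carrier A" using h by simp
    have "cls ([Inl h] @ [x]) = cls [Inl (h \<otimes>\<^bsub>A\<^esub> a)]"
      using Inl cls_cong[OF fp_eq.mult_left[OF h(1) a]] by simp
    then show ?thesis
      using kernel_part_A[OF c] \<rho>\<^sub>A_mem[OF c] by (metis InlI append_Cons append_Nil)
  next
    case (Inr b)
    then have b: "b \<in> carrier B" using x by (auto simp: fp_words_def)
    then have c: "\<phi> h \<otimes>\<^bsub>B\<^esub> b \<in> carrier B" using h by simp
    let ?c = "\<phi> h \<otimes>\<^bsub>B\<^esub> b"
    let ?f = "?c \<otimes>\<^bsub>B\<^esub> inv\<^bsub>B\<^esub> \<rho>\<^sub>B ?c"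
    have k: "\<rho>\<^sub>B ?c \<in> K" using \<rho>\<^sub>B_mem[OF c] .
    have "cls ([Inl h] @ [x]) = cls [Inr (\<phi> h)] \<otimes>\<^bsub>G\<^esub> cls [Inr b]"
      using Inr cls_append letters h b cls_amalgamate[OF v(2)] by metis
    also have "\<dots> = cls [Inr ?c]"
      using cls_append letters h b cls_cong[OF fp_eq.mult_right[OF h(2) b]] by (metis append_Cons append_Nil)
    also have "\<dots> = cls ([Inr ?f] @ [Inr (\<rho>\<^sub>B ?c)])"
      using kernel_part_B(2)[OF c] by simp
    also have "\<dots> = cls [Inr ?f] \<otimes>\<^bsub>G\<^esub> cls [Inr (\<rho>\<^sub>B ?c)]"
      using c by (intro cls_append) (auto simp: fp_words_def)
    \<comment> \<open>The remainder lies in K and is moved back to H across the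
      amalgamation.\<close>
    also have "\<dots> = cls [Inr ?f] \<otimes>\<^bsub>G\<^esub> cls [Inl (\<psi> (\<rho>\<^sub>B ?c))]"
      using cls_amalgamate[OF \<psi>_mem[OF k]] by (simp add: \<phi>_\<psi>[OF k])
    also have "\<dots> = cls ([Inr ?f] @ [Inl (\<psi> (\<rho>\<^sub>B ?c))])"
      using c H.subset \<psi>_mem[OF k] by (intro cls_append[symmetric]) (auto simp: fp_words_def)
    finally show ?thesis
      using kernel_part_B(1)[OF c] \<psi>_mem[OF k] by blast
  qed
  then obtain f h' where f: "f \<in> F\<^sub>A <+> F\<^sub>B" "h' \<in> H" "cls ([Inl h] @ [x]) = cls ([f] @ [Inl h'])"
    by blast
  have fw: "[f] \<in> fp_words A B" using f(1) kernel_words_subset by auto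
  have h'w: "[Inl h'] \<in> fp_words A B" using f(2) H.subset by (auto simp: fp_words_def)
  have hw: "[Inl h] \<in> fp_words A B" using h by (auto simp: fp_words_def)
  have "cls (w @ [x]) = cls ((v @ [Inl h]) @ [x])"
    using cls_append[OF w x] cls_append[OF fp_words_append[OF vw hw] x] v(3) by simp
  also have "\<dots> = cls (v @ ([Inl h] @ [x]))" by simp
  also have "\<dots> = cls v \<otimes>\<^bsub>G\<^esub> cls ([f] @ [Inl h'])"
    using cls_append[OF vw fp_words_append[OF hw x]] f(3) by simp
  also have "\<dots> = cls (v @ ([f] @ [Inl h']))"
    using cls_append[OF vw fp_words_append[OF fw h'w]] by simp
  finally have "cls (w @ [x]) = cls ((v @ [f]) @ [Inl h'])" by simp
  moreover have "v @ [f] \<in> lists (F\<^sub>A <+> F\<^sub>B)" using v(1) f(1) by simp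
  ultimately show ?case using f(2) by blast
qed

section \<open>Separating kernel words by homomorphisms of the amalgamated product\<close>

text \<open>\<alpha> and \<beta> need not agree on H, but they can be corrected without changing
  their effect on kernel words. The price is a larger target, in which the word product is visible
  at one coordinate.\<close>

lemma extend_kernel_word:
  assumes Q: "group Q" and \<alpha>: "\<alpha> \<in> hom A Q" and \<beta>: "\<beta> \<in> hom B Q"
  obtains \<Psi> where "\<Psi> \<in> hom G (wreath Q (Q \<times>\<times> Q))"
    "\<And>v. v \<in> lists (F\<^sub>A <+> F\<^sub>B) \<Longrightarrow>
      fst (\<Psi> (cls v)) \<one>\<^bsub>Q \<times>\<times> Q\<^esub> = word_prod Q (map (case_sum \<alpha> \<beta>) v)"
proof -
  interpret Q: group Q by fact
  let ?S = "Q \<times>\<times> Q"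
  interpret S: group ?S using DirProd_group[OF Q Q] .
  let ?W = "wreath Q ?S"
  interpret \<alpha>: group_hom A Q \<alpha> using \<alpha> by unfold_locales
  interpret \<beta>: group_hom B Q \<beta> using \<beta> by unfold_locales
  define \<sigma>\<^sub>A where "\<sigma>\<^sub>A = (\<lambda>a. (\<alpha> (\<rho>\<^sub>A a), \<beta> (\<phi> (\<rho>\<^sub>A a))))"
  define \<sigma>\<^sub>B where "\<sigma>\<^sub>B = (\<lambda>b. (\<alpha> (\<psi> (\<rho>\<^sub>B b)), \<beta> (\<rho>\<^sub>B b)))"
  have \<sigma>\<^sub>A: "\<sigma>\<^sub>A \<in> hom A ?S"
    using hom_compose[OF \<rho>\<^sub>A_hom \<alpha>] hom_compose[OF \<phi>_\<rho>\<^sub>A_hom \<beta>] by (simp add: \<sigma>\<^sub>A_def hom_def Pi_iff)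
  have \<sigma>\<^sub>B: "\<sigma>\<^sub>B \<in> hom B ?S"
    using hom_compose[OF \<psi>_\<rho>\<^sub>B_hom \<alpha>] hom_compose[OF \<rho>\<^sub>B_hom \<beta>] by (simp add: \<sigma>\<^sub>B_def hom_def Pi_iff)
  have q: "fst \<in> carrier ?S \<rightarrow> carrier Q" "snd \<in> carrier ?S \<rightarrow> carrier Q" by auto
  \<comment> \<open>The conjugating functions are the two coordinate projections. They are chosen so
    that for h in H every base value is s_1 \<alpha>(h) (s_1 \<alpha>(h))^-1 = 1, and likewise for
    \<beta> with s_2.\<close>
  define \<Phi>\<^sub>A where "\<Phi>\<^sub>A = (\<lambda>a. (\<lambda>s\<in>carrier ?S.
    fst s \<otimes>\<^bsub>Q\<^esub> \<alpha> a \<otimes>\<^bsub>Q\<^esub> inv\<^bsub>Q\<^esub> fst (s \<otimes>\<^bsub>?S\<^esub> \<sigma>\<^sub>A a), \<sigma>\<^sub>A a))"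
  define \<Phi>\<^sub>B where "\<Phi>\<^sub>B = (\<lambda>b. (\<lambda>s\<in>carrier ?S.
    snd s \<otimes>\<^bsub>Q\<^esub> \<beta> b \<otimes>\<^bsub>Q\<^esub> inv\<^bsub>Q\<^esub> snd (s \<otimes>\<^bsub>?S\<^esub> \<sigma>\<^sub>B b), \<sigma>\<^sub>B b))"
  have \<Phi>\<^sub>A: "\<Phi>\<^sub>A \<in> hom A ?W"
    unfolding \<Phi>\<^sub>A_def by (rule wreath_conjugate_hom) (fact A.is_group Q S.is_group \<alpha> \<sigma>\<^sub>A q)+
  have \<Phi>\<^sub>B: "\<Phi>\<^sub>B \<in> hom B ?W"
    unfolding \<Phi>\<^sub>B_def by (rule wreath_conjugate_hom) (fact B.is_group Q S.is_group \<beta> \<sigma>\<^sub>B q)+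
  \<comment> \<open>Both base parts are trivial on the amalgamated subgroup, and both top parts are
    (\<alpha>(h), \<beta>(\<phi> h)).\<close>
  have "\<Phi>\<^sub>A h = \<Phi>\<^sub>B (\<phi> h)" if h: "h \<in> H" for h
  proof -
    have "h \<in> carrier A" "\<phi> h \<in> carrier B" using h H.subset \<phi>_closed by auto
    moreover have "\<sigma>\<^sub>A h = (\<alpha> h, \<beta> (\<phi> h))" "\<sigma>\<^sub>B (\<phi> h) = (\<alpha> h, \<beta> (\<phi> h))"
      using h by (simp_all add: \<sigma>\<^sub>A_def \<sigma>\<^sub>B_def \<rho>\<^sub>A_id \<rho>\<^sub>B_id \<phi>_mem \<psi>_\<phi>)
    ultimately show ?thesis
      by (auto simp: \<Phi>\<^sub>A_def \<Phi>\<^sub>B_def intro!: restrict_ext)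
  qed
  then obtain \<Psi> where \<Psi>: "\<Psi> \<in> hom G ?W"
      "\<And>w. w \<in> fp_words A B \<Longrightarrow> \<Psi> (cls w) = word_prod ?W (map (case_sum \<Phi>\<^sub>A \<Phi>\<^sub>B) w)"
    using amalgam_extend[OF group_wreath[OF Q S.is_group] \<Phi>\<^sub>A \<Phi>\<^sub>B] by metis
  have prod: "fst (word_prod ?W (map (case_sum \<Phi>\<^sub>A \<Phi>\<^sub>B) v)) \<one>\<^bsub>?S\<^esub> = word_prod Q (map (case_sum \<alpha> \<beta>) v)"
    if "v \<in> lists (F\<^sub>A <+> F\<^sub>B)" for v
    using that
  proof (induction v)
    case Nil
    then show ?case by (simp add: wreath_def)
  next
    case (Cons x v)
    \<comment> \<open>Evaluation at 1 is not multiplicative in general, since the top part y shifts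
      the position. Kernel letters have trivial top part, so the position stays at 1.\<close>
    have mult: "fst ((s, y) \<otimes>\<^bsub>?W\<^esub> u) \<one>\<^bsub>?S\<^esub> = s \<one>\<^bsub>?S\<^esub> \<otimes>\<^bsub>Q\<^esub> fst u (\<one>\<^bsub>?S\<^esub> \<otimes>\<^bsub>?S\<^esub> y)" for s y u
      by (cases u) (simp add: wreath_def)
    obtain s where s: "case_sum \<Phi>\<^sub>A \<Phi>\<^sub>B x = (s, \<one>\<^bsub>?S\<^esub>)" "s \<one>\<^bsub>?S\<^esub> = case_sum \<alpha> \<beta> x"
    proof (cases x)
      case (Inl a)
      then have a: "a \<in> carrier A" "\<rho>\<^sub>A a = \<one>\<^bsub>A\<^esub>" using Cons.hyps by (auto simp: kernel_def)
      have "\<sigma>\<^sub>A a = \<one>\<^bsub>?S\<^esub>"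
        using group_hom.hom_one[of A ?S \<sigma>\<^sub>A] \<sigma>\<^sub>A a by (auto simp: \<sigma>\<^sub>A_def group_hom_def group_hom_axioms_def)
      then show ?thesis using that Inl a by (simp add: \<Phi>\<^sub>A_def)
    next
      case (Inr b)
      then have b: "b \<in> carrier B" "\<rho>\<^sub>B b = \<one>\<^bsub>B\<^esub>" using Cons.hyps by (auto simp: kernel_def)
      have "\<sigma>\<^sub>B b = \<one>\<^bsub>?S\<^esub>"
        using group_hom.hom_one[of B ?S \<sigma>\<^sub>B] \<sigma>\<^sub>B b by (auto simp: \<sigma>\<^sub>B_def group_hom_def group_hom_axioms_def)
      then show ?thesis using that Inr b by (simp add: \<Phi>\<^sub>B_def)
    qed
    then show ?case
      using Cons.IH by (simp only: list.map word_prod_simps mult S.r_one S.one_closed s)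
  qed
  show thesis
  proof (rule that[OF \<Psi>(1)])
    fix v assume v: "v \<in> lists (F\<^sub>A <+> F\<^sub>B)"
    then have "\<Psi> (cls v) = word_prod ?W (map (case_sum \<Phi>\<^sub>A \<Phi>\<^sub>B) v)"
      using kernel_words_subset by (intro \<Psi>(2)) blast
    then show "fst (\<Psi> (cls v)) \<one>\<^bsub>?S\<^esub> = word_prod Q (map (case_sum \<alpha> \<beta>) v)"
      using prod[OF v] by simp
  qed
qed

text \<open>A reduced kernel word is a reduced word in two copies of A x B, hence has nontrivial
  product under suitable \<alpha> and \<beta>; \<open>extend_kernel_word\<close> turns these into
  one homomorphism on \<open>G\<close>.\<close>

lemma separate_reduced_kernel_word:
  assumes N: "finite_root_class N" and "residually_in N A" "residually_in N B"
    and v: "v \<in> lists (F\<^sub>A <+> F\<^sub>B)" "v \<noteq> []" "successively (\<lambda>x y. isl x \<noteq> isl y) v"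
    and ne: "Inl \<one>\<^bsub>A\<^esub> \<notin> set v" "Inr \<one>\<^bsub>B\<^esub> \<notin> set v"
  shows "\<exists>(Q :: nat monoid) \<Psi>. finite_group_in N Q \<and> \<Psi> \<in> hom G Q \<and> \<Psi> (cls v) \<noteq> \<one>\<^bsub>Q\<^esub>"
proof -
  let ?D = "A \<times>\<times> B"
  \<comment> \<open>Letters of \<open>A\<close> go to copy 0 and letters of \<open>B\<close> to copy
    1, so change of factor becomes change of index.\<close>
  define c :: "'a + 'b \<Rightarrow> nat \<times> 'a \<times> 'b"
    where "c = case_sum (\<lambda>a. (0, a, \<one>\<^bsub>B\<^esub>)) (\<lambda>b. (1, \<one>\<^bsub>A\<^esub>, b))"
  have D: "group ?D" using DirProd_group[OF A.is_group B.is_group] .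
  have "\<exists>(Q :: nat monoid) \<gamma>. finite_group_in N Q \<and> (\<forall>i. \<gamma> i \<in> hom ?D Q) \<and>
    word_prod Q (map (\<lambda>a. \<gamma> (fst a) (snd a)) (map c v)) \<noteq> \<one>\<^bsub>Q\<^esub>"
  proof (rule separate_word_of_copies[OF N D residually_in_DirProd[OF assms(2,3)]])
    show "map c v \<noteq> []" using v(2) by simp
    have "fst (c x) \<noteq> fst (c y) \<longleftrightarrow> isl x \<noteq> isl y" for x y
      by (simp add: c_def split: sum.splits)
    then show "successively (\<lambda>a b. fst a \<noteq> fst b) (map c v)"
      using v(3) by (simp add: successively_map)
    fix a assume "a \<in> set (map c v)"
    then obtain x where x: "x \<in> set v" "a = c x" by auto
    then show "snd a \<in> carrier ?D - {\<one>\<^bsub>?D\<^esub>}"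
      using v(1) ne by (cases x) (auto simp: c_def kernel_def)
  qed
  then obtain Q :: "nat monoid" and \<gamma> where Q: "finite_group_in N Q" "\<And>i. \<gamma> i \<in> hom ?D Q"
    "word_prod Q (map (\<lambda>a. \<gamma> (fst a) (snd a)) (map c v)) \<noteq> \<one>\<^bsub>Q\<^esub>" by blast
  have gQ: "group Q" using Q(1) by (simp add: finite_group_in_def)
  define \<alpha> where "\<alpha> = (\<lambda>a. \<gamma> 0 (a, \<one>\<^bsub>B\<^esub>))"
  define \<beta> where "\<beta> = (\<lambda>b. \<gamma> 1 (\<one>\<^bsub>A\<^esub>, b))"
  have inj: "(\<lambda>a. (a, \<one>\<^bsub>B\<^esub>)) \<in> hom A ?D" "(\<lambda>b. (\<one>\<^bsub>A\<^esub>, b)) \<in> hom B ?D"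
    by (auto simp: hom_def)
  have \<alpha>: "\<alpha> \<in> hom A Q" and \<beta>: "\<beta> \<in> hom B Q"
    using hom_compose[OF inj(1) Q(2)[of 0]] hom_compose[OF inj(2) Q(2)[of 1]]
    by (simp_all add: \<alpha>_def \<beta>_def comp_def)
  obtain \<Psi> where \<Psi>: "\<Psi> \<in> hom G (wreath Q (Q \<times>\<times> Q))"
    "\<And>v. v \<in> lists (F\<^sub>A <+> F\<^sub>B) \<Longrightarrow>
      fst (\<Psi> (cls v)) \<one>\<^bsub>Q \<times>\<times> Q\<^esub> = word_prod Q (map (case_sum \<alpha> \<beta>) v)"
    using extend_kernel_word[OF gQ \<alpha> \<beta>] by blast
  let ?W = "wreath Q (Q \<times>\<times> Q)"
  have "(\<lambda>a. \<gamma> (fst a) (snd a)) \<circ> c = case_sum \<alpha> \<beta>"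
    by (auto simp: c_def \<alpha>_def \<beta>_def split: sum.splits)
  then have "fst (\<Psi> (cls v)) \<one>\<^bsub>Q \<times>\<times> Q\<^esub> \<noteq> \<one>\<^bsub>Q\<^esub>"
    using Q(3) \<Psi>(2)[OF v(1)] by simp
  moreover have "fst \<one>\<^bsub>?W\<^esub> \<one>\<^bsub>Q \<times>\<times> Q\<^esub> = \<one>\<^bsub>Q\<^esub>"
    using group.is_monoid[OF gQ] by (simp add: wreath_def monoid.one_closed)
  ultimately have ne1: "\<Psi> (cls v) \<noteq> \<one>\<^bsub>?W\<^esub>" by metis
  have W: "finite_group_in N ?W"
    using wreath_finite_group_in[OF N Q(1) DirProd_finite_group_in[OF N Q(1) Q(1)]] .
  obtain R :: "nat monoid" and i where R: "finite_group_in N R" "i \<in> hom ?W R" "inj_on i (carrier ?W)"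
    using finite_group_in_nat[OF W] by blast
  have "\<Psi> (cls v) \<in> carrier ?W"
    using hom_in_carrier[OF \<Psi>(1)] cls_closed kernel_words_subset v(1) by blast
  then have "i (\<Psi> (cls v)) \<noteq> \<one>\<^bsub>R\<^esub>"
    using hom_neq_one[of ?W R i] W R ne1 by (simp add: finite_group_in_def)
  then show ?thesis
    using R(1) hom_compose[OF \<Psi>(1) R(2)] by (intro exI[of _ R] exI[of _ "i \<circ> \<Psi>"]) simp
qed

lemma residually_in_G:
  assumes N: "finite_root_class N" and res: "residually_in N A" "residually_in N B"
  shows "residually_in N G"
  unfolding residually_in_def
proof (intro ballI impI)
  interpret G: group G by (rule group_G)
  fix g assume g: "g \<in> carrier G" "g \<noteq> \<one>\<^bsub>G\<^esub>"
  obtain w where w: "w \<in> fp_words A B" "g = cls w" using cls_surj[OF g(1)] by blast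
  obtain v h where v: "v \<in> lists (F\<^sub>A <+> F\<^sub>B)" "h \<in> H" "g = cls (v @ [Inl h])"
    using kernel_word_times_H[OF w(1)] w(2) by blast
  have words: "v \<in> fp_words A B" "[Inl h] \<in> fp_words A B"
    using v(1,2) kernel_words_subset H.subset by (auto simp: fp_words_def)
  show "\<exists>(Q :: nat monoid) \<psi>. finite_group_in N Q \<and> \<psi> \<in> hom G Q \<and> \<psi> g \<noteq> \<one>\<^bsub>Q\<^esub>"
  proof (cases "h = \<one>\<^bsub>A\<^esub>")
    \<comment> \<open>The retraction of \<open>G\<close> to H kills the kernel letters and sends g
      to h, which \<open>A\<close> can separate from 1.\<close>
    case False
    have "\<rho>\<^sub>A k = \<psi> (\<rho>\<^sub>B (\<phi> k))" if "k \<in> H" for k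
      using that by (simp add: \<rho>\<^sub>A_id \<rho>\<^sub>B_id \<phi>_mem \<psi>_\<phi>)
    then obtain \<Psi> where \<Psi>: "\<Psi> \<in> hom G A"
        "\<And>w. w \<in> fp_words A B \<Longrightarrow> \<Psi> (cls w) = word_prod A (map (case_sum \<rho>\<^sub>A (\<lambda>b. \<psi> (\<rho>\<^sub>B b))) w)"
      using amalgam_extend[OF A.is_group \<rho>\<^sub>A_hom \<psi>_\<rho>\<^sub>B_hom] by metis
    have "\<psi> \<one>\<^bsub>B\<^esub> = \<one>\<^bsub>A\<^esub>"
      using hom_one[OF \<psi>_\<rho>\<^sub>B_hom B.is_group A.is_group] by simp
    then have "word_prod A (map (case_sum \<rho>\<^sub>A (\<lambda>b. \<psi> (\<rho>\<^sub>B b))) (v @ [Inl h])) = h"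
      using v(1)
    proof (induction v)
      case Nil
      then show ?case using v(2) by (simp add: \<rho>\<^sub>A_id)
    next
      case (Cons x v)
      then show ?case using v(2) by (auto simp: kernel_def)
    qed
    then have h: "\<Psi> g = h"
      using \<Psi>(2)[OF fp_words_append[OF words]] v(3) by simp
    obtain Q :: "nat monoid" and \<theta> where "finite_group_in N Q" "\<theta> \<in> hom A Q" "\<theta> h \<noteq> \<one>\<^bsub>Q\<^esub>"
      using res(1) False v(2) H.subset by (auto simp: residually_in_def)
    then show ?thesis
      using h hom_compose[OF \<Psi>(1)] by (intro exI[of _ Q] exI[of _ "\<theta> \<circ> \<Psi>"]) simp
  next
    case True
    have "cls [Inl \<one>\<^bsub>A\<^esub>] = \<one>\<^bsub>G\<^esub>"
      using cls_cong[OF fp_eq.one_left] cls_Nil by simp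
    then have gv: "g = cls v"
      using cls_append[OF words] v(3) True cls_closed[OF words(1)] by simp
    obtain u where u: "u \<in> lists (F\<^sub>A <+> F\<^sub>B)" "fp_eq A B v u" "successively (\<lambda>x y. isl x \<noteq> isl y) u"
        "Inl \<one>\<^bsub>A\<^esub> \<notin> set u" "Inr \<one>\<^bsub>B\<^esub> \<notin> set u"
      using reduce_word[OF A.is_group B.is_group \<rho>\<^sub>A.subgroup_kernel \<rho>\<^sub>B.subgroup_kernel v(1)] by blast
    have gu: "g = cls u" using gv cls_cong[OF u(2)] by simp
    \<comment> \<open>An empty reduced word would represent the unit, contrary to the choice of
      g.\<close>
    moreover have "u \<noteq> []" using g(2) gu cls_Nil by auto
    ultimately show ?thesis
      using separate_reduced_kernel_word[OF N res u(1) _ u(3-5)] by simp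
  qed
qed

lemma residually_in_iff:
  "finite_root_class N \<Longrightarrow> residually_in N G \<longleftrightarrow> residually_in N A \<and> residually_in N B"
  using residually_in_G residually_in_A residually_in_B by blast

end

theorem mainTheorem2:
  fixes A :: "('a, 'm) monoid_scheme" and B :: "('b, 'n) monoid_scheme"
    and H :: "'a set" and K :: "'b set" and \<phi> :: "'a \<Rightarrow> 'b" and p :: nat
  assumes "group A" and "group B"
    and "subgroup H A" and "subgroup K B"
    and "\<phi> \<in> iso (A\<lparr>carrier := H\<rparr>) (B\<lparr>carrier := K\<rparr>)"
    and "retract_of H A" and "retract_of K B"
    and "Factorial_Ring.prime p"
  shows "(residually_finite (amalgamated_product A B H \<phi>) \<longleftrightarrow>
            residually_finite A \<and> residually_finite B) \<and>
         (residually_p_finite p (amalgamated_product A B H \<phi>) \<longleftrightarrow>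
            residually_p_finite p A \<and> residually_p_finite p B)"
proof -
  interpret A: group A by fact
  interpret B: group B by fact
  obtain \<rho>\<^sub>A where \<rho>\<^sub>A: "\<rho>\<^sub>A \<in> hom A A" "\<And>a. a \<in> carrier A \<Longrightarrow> \<rho>\<^sub>A a \<in> H" "\<And>h. h \<in> H \<Longrightarrow> \<rho>\<^sub>A h = h"
    using A.retract_of_retraction[OF assms(6)] by blast
  obtain \<rho>\<^sub>B where \<rho>\<^sub>B: "\<rho>\<^sub>B \<in> hom B B" "\<And>b. b \<in> carrier B \<Longrightarrow> \<rho>\<^sub>B b \<in> K" "\<And>k. k \<in> K \<Longrightarrow> \<rho>\<^sub>B k = k"
    using B.retract_of_retraction[OF assms(7)] by blast
  \<comment> \<open>Since \<phi> is a bijection from \<open>H\<close> to \<open>K\<close>, this is a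
    two-sided inverse between them.\<close>
  let ?\<psi> = "inv_into H \<phi>"
  have \<phi>: "\<phi> \<in> hom (A\<lparr>carrier := H\<rparr>) (B\<lparr>carrier := K\<rparr>)" "inj_on \<phi> H" "\<phi> ` H = K"
    using assms(5) by (auto simp: iso_def bij_betw_def)
  have "?\<psi> \<in> iso (B\<lparr>carrier := K\<rparr>) (A\<lparr>carrier := H\<rparr>)"
    using group.iso_set_sym[OF A.subgroup_imp_group[OF assms(3)] assms(5)] by simp
  then have \<psi>: "?\<psi> \<in> hom (B\<lparr>carrier := K\<rparr>) (A\<lparr>carrier := H\<rparr>)"
    by (simp add: iso_def)
  interpret retract_amalgam A B H \<phi> K ?\<psi> \<rho>\<^sub>A \<rho>\<^sub>B
  proof (intro retract_amalgam.intro amalgam.intro amalgam_axioms.intro retract_amalgam_axioms.intro)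
    show "H \<subseteq> carrier A" using assms(3) by (rule subgroup.subset)
    show "\<phi> h \<in> carrier B" if "h \<in> H" for h
      using that \<phi>(3) subgroup.subset[OF assms(4)] by auto
    show "?\<psi> (\<phi> h) = h" if "h \<in> H" for h using \<phi>(2) that by simp
    show "\<phi> (?\<psi> k) = k" if "k \<in> K" for k using \<phi>(3) that by (simp add: f_inv_into_f)
  qed (fact assms \<phi>(1) \<psi> \<rho>\<^sub>A \<rho>\<^sub>B)+
  \<comment> \<open>The two claims are the cases of all orders and of the powers of p.\<close>
  show ?thesis
    using residually_in_iff[OF finite_root_class_UNIV]
      residually_in_iff[OF finite_root_class_prime_powers[OF assms(8)]]
    by (simp add: residually_finite_iff residually_p_finite_iff group_G A.is_group B.is_group assms(8))
qed

end
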